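(* Let $n\ge 2$, let $m=(m_1,\dots,m_n)\in\mathbb{N}^n$, $|M|=m_1+\cdots+m_n$, and let $\vec v={}^t[a_1,a_2,c,d,e_1,e_2]$ and $x=(x_1,\dots,x_n)$ be generic complex parameters satisfying the balancing condition $$a_1+a_2+c+1-|M|=d+e_1+e_2 .$$ Define $$\widetilde F(\vec v,x):=[e_1]_{|M|}\,[e_2]_{|M|}\prod_{1\le i\le n}[d+x_i]_{m_i}\cdot F(\vec v,x),$$ where $F(\vec v,x)$ is the rectangular $A_n$ ${}_4F_3$ series defined in the context. Then $\widetilde F$ is invariant under the transformations $s_0,s_1,s_2$ of $(\vec v,x)$ defined in the context, i.e. $\widetilde F(s_i(\vec v,x))=\widetilde F(\vec v,x)$ for $i=0,1,2$.
   Context: $\mathbb{N}$ denotes the nonnegative integers, $[z]_k=z(z+1)\cdots(z+k-1)$ (with $[z]_0=1$). For $\gamma\in\mathbb{N}^n$, $|\gamma|=\gamma_1+\cdots+\gamma_n$; $\Delta(x)=\prod_{1\le i<j\le n}(x_i-x_j)$ and $\Delta(x+\gamma)=\prod_{1\le i<j\le n}(x_i+\gamma_i-x_j-\gamma_j)$. The series is $$F(\vec v,x)=\sum_{\gamma\in\mathbb{N}^n}\frac{\Delta(x+\gamma)}{\Delta(x)}\prod_{1\le i,j\le n}\frac{[-m_j+x_i-x_j]_{\gamma_i}}{[1+x_i-x_j]_{\gamma_i}}\prod_{1\le i\le n}\frac{[c+x_i]_{\gamma_i}}{[d+x_i]_{\gamma_i}}\cdot\frac{[a_1]_{|\gamma|}[a_2]_{|\gamma|}}{[e_1]_{|\gamma|}[e_2]_{|\gamma|}},$$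 which terminates (only $\gamma_i\le m_i$ contribute). The multi-index $m$ is fixed. The transformations are: $s_0$ exchanges $a_1$ and $a_2$ and fixes everything else (including $x$); $s_2$ exchanges $e_1$ and $e_2$ and fixes everything else (including $x$); $s_1$ sends $(a_1,a_2,c,d,e_1,e_2)$ to $(a_1,\ e_1-a_2,\ e_1-c,\ e_1+e_2-a_2-c,\ e_1,\ e_1+d-a_2-c)$ and $x_i$ to $\tilde x_i=-m_i+|M|-x_i$ for $1\le i\le n$. "Generic" means that all denominators occurring are nonzero (the identities may be read as identities of rational functions on the hyperplane defined by the balancing condition). *)

theory Defs
  imports "HOL-Analysis.Analysis"
begin

text \<open>
  Indices run over \<open>{1..n}\<close>; vectors are functions on \<open>nat\<close> of which only the values on
  \<open>{1..n}\<close> matter. The shifted factorial \<open>[z]\<^sub>k\<close> is \<^const>\<open>pochhammer\<close>.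
\<close>

text \<open>The parameter vector \<open>(a\<^sub>1, a\<^sub>2, c, d, e\<^sub>1, e\<^sub>2)\<close>.\<close>

type_synonym params = "complex \<times> complex \<times> complex \<times> complex \<times> complex \<times> complex"

type_synonym point = "params \<times> (nat \<Rightarrow> complex)"

definition size_of :: "nat \<Rightarrow> (nat \<Rightarrow> nat) \<Rightarrow> nat" where
  "size_of n \<gamma> = (\<Sum>i\<in>{1..n}. \<gamma> i)"

definition Delta :: "nat \<Rightarrow> (nat \<Rightarrow> complex) \<Rightarrow> complex" where
  "Delta n y = (\<Prod>i\<in>{1..n}. \<Prod>j\<in>{i<..n}. y i - y j)"

text \<open>The set \<open>\<nat>\<^sup>n\<close>; extensionality makes each multi-index occur exactly once.\<close>

definition multi_indices :: "nat \<Rightarrow> (nat \<Rightarrow> nat) set" where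
  "multi_indices n = {1..n} \<rightarrow>\<^sub>E UNIV"

fun F_term :: "nat \<Rightarrow> (nat \<Rightarrow> nat) \<Rightarrow> point \<Rightarrow> (nat \<Rightarrow> nat) \<Rightarrow> complex" where
  "F_term n m ((a1, a2, c, d, e1, e2), x) \<gamma> =
     Delta n (\<lambda>i. x i + of_nat (\<gamma> i)) / Delta n x
     * (\<Prod>i\<in>{1..n}. \<Prod>j\<in>{1..n}.
          pochhammer (- of_nat (m j) + x i - x j) (\<gamma> i) / pochhammer (1 + x i - x j) (\<gamma> i))
     * (\<Prod>i\<in>{1..n}. pochhammer (c + x i) (\<gamma> i) / pochhammer (d + x i) (\<gamma> i))
     * ((pochhammer a1 (size_of n \<gamma>) * pochhammer a2 (size_of n \<gamma>))
        / (pochhammer e1 (size_of n \<gamma>) * pochhammer e2 (size_of n \<gamma>)))"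

definition F :: "nat \<Rightarrow> (nat \<Rightarrow> nat) \<Rightarrow> point \<Rightarrow> complex" where
  "F n m p = (\<Sum>\<^sub>\<infinity>\<gamma>\<in>multi_indices n. F_term n m p \<gamma>)"

fun F_tilde :: "nat \<Rightarrow> (nat \<Rightarrow> nat) \<Rightarrow> point \<Rightarrow> complex" where
  "F_tilde n m ((a1, a2, c, d, e1, e2), x) =
     pochhammer e1 (size_of n m) * pochhammer e2 (size_of n m)
     * (\<Prod>i\<in>{1..n}. pochhammer (d + x i) (m i))
     * F n m ((a1, a2, c, d, e1, e2), x)"

text \<open>
  No denominator of a contributing term (\<open>\<gamma>\<^sub>i \<le> m\<^sub>i\<close> for all \<open>i\<close>) vanishes. The remaining
  terms have the factor \<open>[-m\<^sub>i]\<^bsub>\<gamma>\<^sub>i\<^esub> = 0\<close> for some \<open>i\<close>, so they are \<open>0\<close> also with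
  the convention \<open>z / 0 = 0\<close>, and nothing is required of their denominators.
\<close>

fun denominators_nonzero :: "nat \<Rightarrow> (nat \<Rightarrow> nat) \<Rightarrow> point \<Rightarrow> bool" where
  "denominators_nonzero n m ((a1, a2, c, d, e1, e2), x) \<longleftrightarrow>
     Delta n x \<noteq> 0 \<and>
     (\<forall>\<gamma>\<in>multi_indices n. (\<forall>i\<in>{1..n}. \<gamma> i \<le> m i) \<longrightarrow>
        (\<forall>i\<in>{1..n}. \<forall>j\<in>{1..n}. pochhammer (1 + x i - x j) (\<gamma> i) \<noteq> 0) \<and>
        (\<forall>i\<in>{1..n}. pochhammer (d + x i) (\<gamma> i) \<noteq> 0) \<and>
        pochhammer e1 (size_of n \<gamma>) \<noteq> 0 \<and> pochhammer e2 (size_of n \<gamma>) \<noteq> 0)"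

fun s0 :: "point \<Rightarrow> point" where
  "s0 ((a1, a2, c, d, e1, e2), x) = ((a2, a1, c, d, e1, e2), x)"

fun s1 :: "nat \<Rightarrow> (nat \<Rightarrow> nat) \<Rightarrow> point \<Rightarrow> point" where
  "s1 n m ((a1, a2, c, d, e1, e2), x) =
     ((a1, e1 - a2, e1 - c, e1 + e2 - a2 - c, e1, e1 + d - a2 - c),
      (\<lambda>i. - of_nat (m i) + of_nat (size_of n m) - x i))"

fun s2 :: "point \<Rightarrow> point" where
  "s2 ((a1, a2, c, d, e1, e2), x) = ((a1, a2, c, d, e2, e1), x)"

lemma F_term_eq_0:
  assumes "i \<in> {1..n}" "m i < \<gamma> i"
  shows "F_term n m p \<gamma> = 0"
proof -
  obtain a1 a2 c d e1 e2 x where p: "p = ((a1, a2, c, d, e1, e2), x)"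
    by (metis prod.collapse)
  let ?q = "\<lambda>i j. pochhammer (- of_nat (m j) + x i - x j) (\<gamma> i) / pochhammer (1 + x i - x j) (\<gamma> i)"
  have 0: "?q i i = 0"
    using assms(2) by (simp add: pochhammer_of_nat_eq_0_lemma)
  have 1: "(\<Prod>j\<in>{1..n}. ?q i j) = 0"
    by (rule prod_zero) (simp, use 0 assms(1) in blast)
  have "(\<Prod>i\<in>{1..n}. \<Prod>j\<in>{1..n}. ?q i j) = 0"
    by (rule prod_zero) (simp, use 1 assms(1) in blast)
  then show ?thesis
    unfolding p F_term.simps by simp
qed

text \<open>The series terminates, so the infinite sum in \<^const>\<open>F\<close> is a finite one.\<close>

lemma F_has_sum:
  "(F_term n m p has_sum (\<Sum>\<gamma>\<in>(\<Pi>\<^sub>E i\<in>{1..n}. {..m i}). F_term n m p \<gamma>)) (multi_indices n)"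
proof (rule has_sum_finite_neutralI)
  show "finite (\<Pi>\<^sub>E i\<in>{1..n}. {..m i})"
    by (simp add: finite_PiE)
  show "(\<Pi>\<^sub>E i\<in>{1..n}. {..m i}) \<subseteq> multi_indices n"
    by (auto simp: multi_indices_def PiE_iff)
  fix \<gamma>
  assume "\<gamma> \<in> multi_indices n - (\<Pi>\<^sub>E i\<in>{1..n}. {..m i})"
  then obtain i where "i \<in> {1..n}" "m i < \<gamma> i"
    by (force simp: multi_indices_def PiE_iff)
  then show "F_term n m p \<gamma> = 0"
    by (rule F_term_eq_0)
qed simp

lemma F_eq_finite_sum:
  "F n m p = (\<Sum>\<gamma>\<in>(\<Pi>\<^sub>E i\<in>{1..n}. {..m i}). F_term n m p \<gamma>)"
  unfolding F_def by (rule infsumI) (rule F_has_sum)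

end

theory Submission
  imports Defs
begin

text \<open>
  The series is symmetric in \<open>a\<^sub>1, a\<^sub>2\<close> and in \<open>e\<^sub>1, e\<^sub>2\<close>, so only \<open>s\<^sub>1\<close> needs an argument.
  The idea is to replace the multi-index sum by a sum over subsets, which turns the multiple series
  into a polarization of the one-variable series.

  Let \<open>N = |M|\<close>. For a set \<open>S\<close> of \<open>N\<close> distinct numbers and weights \<open>w\<close> put
  \<open>T(S) = \<Sum>\<^bsub>K \<subseteq> S\<^esub> w(|K|) \<Prod>\<^bsub>u \<in> K, v \<in> S - K\<^esub> (u - v - 1)/(u - v) \<cdot> \<Prod>\<^bsub>u \<in> K\<^esub> (c + u) \<cdot> \<Prod>\<^bsub>v \<in> S - K\<^esub> (d + v)\<close>.
  If \<open>S\<close> is the union of the blocks \<open>{x\<^sub>i, x\<^sub>i + 1, \<dots>, x\<^sub>i + m\<^sub>i - 1}\<close>, then a subset \<open>K\<close> contributes only if it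
  contains with \<open>v + 1\<close> also \<open>v\<close>, for \<open>v \<in> S\<close>. Such a \<open>K\<close> consists of initial segments of the blocks, of
  lengths \<open>\<gamma>\<^sub>i \<le> m\<^sub>i\<close>, and its term is the term of the normalized series at \<open>\<gamma>\<close>
  (\<open>subset_sum_blocks\<close>, \<open>F_tilde_eq_subset_sum\<close>). The numbers \<open>x'\<^sub>i = |M| - m\<^sub>i - x\<^sub>i\<close> belong in the same
  way to the reflected set \<open>N - 1 - S\<close> (\<open>blocks_reflect\<close>).

  The function \<open>T\<close> is affine in each element of \<open>S\<close>: the poles at coinciding elements cancel, and the growth
  is at most linear (\<open>subset_sum_affine\<close>). A set function with this property is determined by its values
  on the chains \<open>{z, z + 1, \<dots>, z + N - 1}\<close> (\<open>affine_in_each_zero_if_zero_on_chains\<close>). On a chain only the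
  initial segments contribute, and \<open>T\<close> is a terminating one-variable series (\<open>subset_sum_chain\<close>). For it
  the invariance under \<open>s\<^sub>1\<close> is the transformation of Whipple and Sears for balanced \<open>\<^sub>4F\<^sub>3\<close> series
  (\<open>sears\<close>), which follows from two applications of the Pfaff--Saalschuetz sum (\<open>saalschuetz\<close>).
\<close>

section \<open>The one-variable transformation of Whipple and Sears\<close>

lemma pochhammer_reflect:
  fixes z :: "'a::comm_ring_1"
  shows "pochhammer (1 - z - of_nat k) k = (-1) ^ k * pochhammer z k"
proof -
  have "pochhammer z k = (-1) ^ k * pochhammer (- z - of_nat k + 1) k"
    using pochhammer_minus[of "-z" k] by simp
  moreover have "- z - of_nat k + 1 = 1 - z - of_nat k" by simp
  ultimately show ?thesis
    by (simp add: mult.assoc[symmetric] power_add[symmetric] mult_2[symmetric] power_mult)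
qed

text \<open>
  The Pfaff--Saalschuetz sum with all denominators cleared. The usual lower parameter
  \<open>1 + a + c - d - N\<close> has been reflected into the last factor, which builds the balancing
  condition into the summand and leaves \<open>a, c, d\<close> free. The proof is by the recurrence
  \<open>S(N + 1) = (d - a + N)(d - c + N) S(N)\<close>: the summands of the difference of its two sides telescope.
\<close>

lemma saalschuetz:
  fixes a c d :: "'a::comm_ring_1"
  shows "(\<Sum>k\<le>N. of_nat (N choose k) * pochhammer a k * pochhammer c k
            * pochhammer (d + of_nat k) (N - k) * pochhammer (d - a - c) (N - k))
         = pochhammer (d - a) N * pochhammer (d - c) N"
proof (induction N)
  case 0
  then show ?case by simp
next
  case (Suc N)
  define p where "p = d - a - c"
  define q where "q = (d - a + of_nat N) * (d - c + of_nat N)"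
  define B where "B = (\<lambda>k. of_nat (N choose k) * pochhammer a k * pochhammer c k)"
  define U where "U = (\<lambda>k. B k * pochhammer (d + of_nat k) (N - k) * pochhammer p (N - k))"
  \<comment> \<open>\<open>X k\<close> and \<open>Y (k - 1)\<close> are the two parts of the \<open>k\<close>-th summand for \<open>N + 1\<close> under Pascal's rule\<close>
  define X where "X = (\<lambda>k. B k * pochhammer (d + of_nat k) (Suc N - k) * pochhammer p (Suc N - k))"
  define Y where "Y = (\<lambda>k. B k * (a + of_nat k) * (c + of_nat k)
      * pochhammer (d + of_nat (Suc k)) (N - k) * pochhammer p (N - k))"
  \<comment> \<open>the telescoping certificate: one shift of \<open>U\<close> in its last factor, times \<open>k\<close>\<close>
  define G where "G = (\<lambda>k. of_nat k * B k * pochhammer (d + of_nat k) (N - k) * pochhammer p (Suc N - k))"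
  have tele: "X k + Y k = q * U k + (G (Suc k) - G k)" if "k \<le> N" for k
  proof (cases "k = N")
    case True
    have "N choose Suc N = 0" by (rule binomial_eq_0) simp
    then have "G (Suc N) = 0" by (simp only: G_def B_def of_nat_0 mult_zero_left mult_zero_right)
    with True show ?thesis
      by (simp add: X_def Y_def U_def G_def q_def p_def B_def algebra_simps)
  next
    case False
    with that obtain r where r: "N = k + Suc r"
      using less_imp_Suc_add by (metis add_Suc_right le_neq_implies_less)
    have B: "of_nat (Suc k) * B (Suc k) = (of_nat (Suc r) :: 'a) * B k * (a + of_nat k) * (c + of_nat k)"
    proof -
      have "Suc k * (N choose Suc k) = Suc r * (N choose k)"
        using binomial_absorption[of k N] binomial_absorb_comp[of N k] r by simp
      then have "of_nat (Suc k) * of_nat (N choose Suc k) = (of_nat (Suc r) * of_nat (N choose k) :: 'a)"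
        by (metis of_nat_mult)
      moreover have "of_nat (Suc k) * B (Suc k) = (of_nat (Suc k) * of_nat (N choose Suc k))
          * (pochhammer a k * (a + of_nat k)) * (pochhammer c k * (c + of_nat k))"
        by (simp only: B_def pochhammer_Suc mult.assoc)
      ultimately show ?thesis by (simp only: B_def mult_ac)
    qed
    define P where "P = pochhammer p (Suc r)"
    define D where "D = pochhammer (d + of_nat k + 1) r"
    have 1: "pochhammer (d + of_nat k) (N - k) = (d + of_nat k) * D"
      by (simp add: r D_def pochhammer_rec)
    have 2: "pochhammer (d + of_nat k) (Suc N - k) = (d + of_nat k) * D * (d + of_nat k + 1 + of_nat r)"
    proof -
      have "Suc N - k = Suc (Suc r)" by (simp add: r)
      then show ?thesis
        by (simp only: D_def pochhammer_rec[of "d + of_nat k" "Suc r"]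
            pochhammer_Suc[of "d + of_nat k + 1" r] mult.assoc)
    qed
    have 3: "pochhammer (d + of_nat (Suc k)) (N - k) = D * (d + of_nat k + 1 + of_nat r)"
      by (simp add: r D_def pochhammer_Suc algebra_simps)
    have 4: "pochhammer (d + of_nat (Suc k)) (N - Suc k) = D"
      by (simp add: r D_def algebra_simps)
    have 5: "pochhammer p (Suc N - k) = P * (p + of_nat r + 1)"
      by (simp add: r P_def pochhammer_Suc[of p "Suc r"] Suc_diff_le algebra_simps)
    have 6: "pochhammer p (N - k) = P" "pochhammer p (Suc N - Suc k) = P"
      by (simp_all add: r P_def)
    have "G (Suc k) = of_nat (Suc r) * B k * (a + of_nat k) * (c + of_nat k) * D * P"
      using B by (simp only: G_def 4 6)
    moreover have "X k = B k * ((d + of_nat k) * D * (d + of_nat k + 1 + of_nat r)) * (P * (p + of_nat r + 1))"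
      by (simp only: X_def 2 5)
    moreover have "Y k = B k * (a + of_nat k) * (c + of_nat k) * (D * (d + of_nat k + 1 + of_nat r)) * P"
      by (simp only: Y_def 3 6)
    moreover have "U k = B k * ((d + of_nat k) * D) * P"
      by (simp only: U_def 1 6)
    moreover have "G k = of_nat k * B k * ((d + of_nat k) * D) * (P * (p + of_nat r + 1))"
      by (simp only: G_def 1 5)
    moreover have "of_nat N = (of_nat k + of_nat r + 1 :: 'a)" by (simp add: r)
    ultimately show ?thesis
      by (simp only: q_def) (simp add: p_def algebra_simps)
  qed
  have "(\<Sum>k\<le>Suc N. of_nat (Suc N choose k) * pochhammer a k * pochhammer c k
            * pochhammer (d + of_nat k) (Suc N - k) * pochhammer p (Suc N - k))
      = (\<Sum>k\<le>Suc N. X k + (case k of 0 \<Rightarrow> 0 | Suc k \<Rightarrow> Y k))"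
    by (intro sum.cong refl)
      (auto simp: X_def Y_def B_def pochhammer_Suc algebra_simps split: nat.split)
  also have "\<dots> = (\<Sum>k\<le>N. X k + Y k)"
  proof -
    have "N choose Suc N = 0" by (rule binomial_eq_0) simp
    then have "X (Suc N) = 0" by (simp only: X_def B_def of_nat_0 mult_zero_left)
    then show ?thesis
      by (subst sum.distrib, subst (2) sum.atMost_Suc_shift) (simp add: sum.distrib)
  qed
  also have "\<dots> = (\<Sum>k\<le>N. q * U k + (G (Suc k) - G k))"
    by (intro sum.cong refl tele) simp
  also have "\<dots> = q * (\<Sum>k\<le>N. U k) + (G (Suc N) - G 0)"
    using sum_lessThan_telescope[of G "Suc N"]
    by (simp add: sum.distrib sum_distrib_left lessThan_Suc_atMost del: sum.lessThan_Suc)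
  also have "G (Suc N) - G 0 = 0"
  proof -
    have "N choose Suc N = 0" by (rule binomial_eq_0) simp
    then show ?thesis
      by (simp only: G_def B_def of_nat_0 mult_zero_left mult_zero_right diff_self)
  qed
  also have "(\<Sum>k\<le>N. U k) = pochhammer (d - a) N * pochhammer (d - c) N"
    using Suc.IH by (simp add: U_def B_def p_def)
  finally show ?case
    by (simp add: p_def q_def pochhammer_Suc algebra_simps)
qed

text \<open>
  Expand \<open>[a\<^sub>2]\<^sub>k [c]\<^sub>k\<close> by the Saalschuetz sum with parameters \<open>e\<^sub>1 - a\<^sub>2\<close>, \<open>e\<^sub>1 - c\<close>, \<open>e\<^sub>1\<close> and exchange the
  summations; the balancing condition makes the inner sum again a Saalschuetz sum. The
  denominators are cleared because the identity is used on chains with an arbitrary starting point, which is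
  added to \<open>c\<close> and to \<open>d\<close>.
\<close>

lemma sears:
  fixes a1 a2 c d e1 e2 :: "'a::comm_ring_1"
  assumes bal: "a1 + a2 + c + 1 - of_nat N = d + e1 + e2"
  shows "(\<Sum>k\<le>N. (-1) ^ k * of_nat (N choose k) * pochhammer a1 k * pochhammer a2 k * pochhammer c k
            * pochhammer (d + of_nat k) (N - k) * pochhammer (e1 + of_nat k) (N - k)
            * pochhammer (e2 + of_nat k) (N - k))
       = (\<Sum>k\<le>N. (-1) ^ k * of_nat (N choose k) * pochhammer a1 k * pochhammer (e1 - a2) k
            * pochhammer (e1 - c) k
            * pochhammer (e1 + e2 - a2 - c + of_nat k) (N - k) * pochhammer (e1 + of_nat k) (N - k)
            * pochhammer (e1 + d - a2 - c + of_nat k) (N - k))"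
    (is "(\<Sum>k\<le>N. ?L k) = (\<Sum>k\<le>N. ?R k)")
proof -
  define q where "q = a2 + c - e1"
  define H where "H = (\<lambda>k j. (-1) ^ k * of_nat (N choose k) * of_nat (k choose j) * pochhammer a1 k
      * pochhammer (d + of_nat k) (N - k) * pochhammer (e1 + of_nat j) (N - j)
      * pochhammer (e2 + of_nat k) (N - k) * pochhammer (e1 - a2) j * pochhammer (e1 - c) j
      * pochhammer q (k - j))"
  have L: "?L k = (\<Sum>j\<le>k. H k j)" if "k \<le> N" for k
  proof -
    have "e1 - (e1 - a2) - (e1 - c) = q" by (simp add: q_def)
    then have *: "(\<Sum>j\<le>k. of_nat (k choose j) * pochhammer (e1 - a2) j * pochhammer (e1 - c) j
            * pochhammer (e1 + of_nat j) (k - j) * pochhammer q (k - j))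
         = pochhammer a2 k * pochhammer c k"
      using saalschuetz[of k "e1 - a2" "e1 - c" e1] by simp
    have e: "pochhammer (e1 + of_nat j) (N - j)
        = pochhammer (e1 + of_nat j) (k - j) * pochhammer (e1 + of_nat k) (N - k)" if "j \<le> k" for j
    proof -
      have "N - j = (k - j) + (N - k)" using that \<open>k \<le> N\<close> by simp
      moreover have "e1 + of_nat j + of_nat (k - j) = e1 + of_nat k"
        using that by (simp add: of_nat_diff)
      ultimately show ?thesis by (metis pochhammer_product')
    qed
    have "?L k = (-1) ^ k * of_nat (N choose k) * pochhammer a1 k
            * pochhammer (d + of_nat k) (N - k) * pochhammer (e1 + of_nat k) (N - k)
            * pochhammer (e2 + of_nat k) (N - k) * (pochhammer a2 k * pochhammer c k)"
      by (simp only: mult_ac)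
    also have "\<dots> = (\<Sum>j\<le>k. H k j)"
      unfolding *[symmetric] sum_distrib_left
    proof (intro sum.cong refl)
      fix j assume "j \<in> {..k}"
      then have "j \<le> k" by simp
      show "(-1) ^ k * of_nat (N choose k) * pochhammer a1 k
            * pochhammer (d + of_nat k) (N - k) * pochhammer (e1 + of_nat k) (N - k)
            * pochhammer (e2 + of_nat k) (N - k) * (of_nat (k choose j) * pochhammer (e1 - a2) j
            * pochhammer (e1 - c) j * pochhammer (e1 + of_nat j) (k - j) * pochhammer q (k - j)) = H k j"
        unfolding H_def e[OF \<open>j \<le> k\<close>] by (simp only: mult_ac)
    qed
    finally show ?thesis .
  qed
  \<comment> \<open>the inner sum after the exchange, with \<open>k = j + i\<close>\<close>
  have R: "(\<Sum>i\<le>N - j. H (j + i) j) = ?R j" if "j \<le> N" for j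
  proof -
    define M where "M = N - j"
    have N: "N = j + M" using that by (simp add: M_def)
    define s where "s = d - a1 - q"
    have s: "s = 1 - e2 - of_nat N"
      using bal by (simp add: s_def q_def algebra_simps)
    have *: "(\<Sum>i\<le>M. of_nat (M choose i) * pochhammer (a1 + of_nat j) i * pochhammer q i
            * pochhammer (d + of_nat j + of_nat i) (M - i) * pochhammer s (M - i))
         = pochhammer (d - a1) M * pochhammer (e1 + d - a2 - c + of_nat j) M"
      using saalschuetz[of M "a1 + of_nat j" q "d + of_nat j"]
      by (simp add: s_def q_def algebra_simps)
    define A where "A = (-1) ^ j * of_nat (N choose j) * pochhammer a1 j * pochhammer (e1 - a2) j
            * pochhammer (e1 - c) j * pochhammer (e1 + of_nat j) M"
    have "H (j + i) j = A * (-1) ^ M * (of_nat (M choose i) * pochhammer (a1 + of_nat j) i * pochhammer q i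
            * pochhammer (d + of_nat j + of_nat i) (M - i) * pochhammer s (M - i))" if i: "i \<le> M" for i
    proof -
      have "pochhammer s (M - i) = (-1) ^ (M - i) * pochhammer (e2 + of_nat (j + i)) (M - i)"
        unfolding s pochhammer_reflect[symmetric] using i by (simp add: N of_nat_diff algebra_simps)
      then have 1: "(-1) ^ M * pochhammer s (M - i) = (-1) ^ i * pochhammer (e2 + of_nat (j + i)) (M - i)"
      proof -
        obtain t where t: "M = i + t" using i le_Suc_ex by blast
        show ?thesis
          using \<open>pochhammer s (M - i) = _\<close>
          by (simp add: t power_add mult.assoc)
      qed
      have "(N choose (j + i)) * ((j + i) choose j) = (N choose j) * (M choose i)"
        using choose_mult[of j "j + i" N] i by (simp add: N)
      then have 2: "of_nat (N choose (j + i)) * of_nat ((j + i) choose j)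
          = (of_nat (N choose j) * of_nat (M choose i) :: 'a)"
        by (metis of_nat_mult)
      have 3: "pochhammer a1 (j + i) = pochhammer a1 j * pochhammer (a1 + of_nat j) i"
        by (rule pochhammer_product')
      have 4: "N - (j + i) = M - i" "j + i - j = i" "N - j = M" by (simp_all add: N)
      have "H (j + i) j = (-1) ^ j * (of_nat (N choose (j + i)) * of_nat ((j + i) choose j))
        * pochhammer a1 (j + i) * pochhammer (d + of_nat (j + i)) (M - i) * pochhammer (e1 + of_nat j) M
        * pochhammer (e1 - a2) j * pochhammer (e1 - c) j * pochhammer q i
        * ((-1) ^ i * pochhammer (e2 + of_nat (j + i)) (M - i))"
        unfolding H_def 4 power_add by (simp only: mult_ac)
      also have "\<dots> = A * (-1) ^ M * (of_nat (M choose i) * pochhammer (a1 + of_nat j) i * pochhammer q i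
            * pochhammer (d + of_nat j + of_nat i) (M - i) * pochhammer s (M - i))"
        unfolding 1[symmetric] 2 3 unfolding A_def of_nat_add add.assoc by (simp only: mult_ac)
      finally show ?thesis .
    qed
    then have "(\<Sum>i\<le>M. H (j + i) j) = A * (-1) ^ M * (pochhammer (d - a1) M * pochhammer (e1 + d - a2 - c + of_nat j) M)"
      unfolding *[symmetric] sum_distrib_left by (intro sum.cong refl) simp
    also have "\<dots> = A * ((-1) ^ M * pochhammer (d - a1) M) * pochhammer (e1 + d - a2 - c + of_nat j) M"
      by (simp only: mult_ac)
    also have "(-1) ^ M * pochhammer (d - a1) M = pochhammer (e1 + e2 - a2 - c + of_nat j) M"
    proof -
      have "1 - (d - a1) - of_nat M = e1 + e2 - a2 - c + of_nat j"
        using bal by (simp add: N algebra_simps)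
      then show ?thesis using pochhammer_reflect[of "d - a1" M] by simp
    qed
    finally show ?thesis
      by (simp only: A_def M_def[symmetric] mult_ac)
  qed
  have "(\<Sum>k\<le>N. ?L k) = (\<Sum>k\<le>N. \<Sum>j\<le>k. H k j)"
    by (intro sum.cong refl L) simp
  also have "\<dots> = (\<Sum>j\<le>N. \<Sum>i\<le>N - j. H (j + i) j)"
    by (simp add: sum.Sigma)
      (rule sum.reindex_bij_witness[of _ "\<lambda>(j, i). (j + i, j)" "\<lambda>(k, j). (j, k - j)"]; force)
  also have "\<dots> = (\<Sum>j\<le>N. ?R j)"
    by (intro sum.cong refl R) simp
  finally show ?thesis .
qed

section \<open>Sums over subsets are affine in each element\<close>

definition subset_sum :: "(nat \<Rightarrow> 'a) \<Rightarrow> 'a \<Rightarrow> 'a \<Rightarrow> 'a::field_char_0 set \<Rightarrow> 'a" where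
  "subset_sum w c d S =
     (\<Sum>K\<in>Pow S. w (card K) * (\<Prod>u\<in>K. \<Prod>v\<in>S - K. (u - v - 1) / (u - v))
        * (\<Prod>u\<in>K. c + u) * (\<Prod>v\<in>S - K. d + v))"

text \<open>
  A set function cannot see repeated elements, so being affine is required only where the new element \<open>u\<close>
  is distinct from the others.
\<close>

definition affine_in_each :: "('a::field_char_0 set \<Rightarrow> 'a) \<Rightarrow> bool" where
  "affine_in_each f \<longleftrightarrow>
     (\<forall>R. finite R \<longrightarrow> (\<exists>\<alpha> \<beta>. \<forall>u. u \<notin> R \<longrightarrow> f (insert u R) = \<alpha> + \<beta> * u))"

lemma prod_linear_factors_dvd:
  fixes Q :: "'a::field poly"
  assumes "finite R" "\<And>r. r \<in> R \<Longrightarrow> poly Q r = 0"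
  shows "(\<Prod>r\<in>R. [:-r, 1:]) dvd Q"
  using assms
proof (induction R)
  case empty
  then show ?case by simp
next
  case (insert r R)
  then obtain L where L: "Q = (\<Prod>r\<in>R. [:-r, 1:]) * L"
    by (auto elim: dvdE)
  have "poly (\<Prod>r\<in>R. [:-r, 1:]) r \<noteq> 0"
    using insert.hyps by (auto simp: poly_prod)
  moreover have "poly Q r = 0" using insert.prems by simp
  ultimately have "poly L r = 0" by (simp add: L)
  then have "[:-r, 1:] dvd L" by (simp add: poly_eq_0_iff_dvd)
  then have "[:-r, 1:] * (\<Prod>r\<in>R. [:-r, 1:]) dvd Q"
    unfolding L by (subst mult.commute) (intro mult_dvd_mono dvd_refl)
  then show ?case
    unfolding prod.insert[OF insert.hyps] .
qed

text \<open>
  The polynomial form of the fact that a rational function with removable poles and at most linear growth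
  is affine.
\<close>

lemma affine_quotient:
  fixes Q :: "'a::field poly"
  assumes "finite R" "degree Q \<le> Suc (card R)" "\<And>r. r \<in> R \<Longrightarrow> poly Q r = 0"
  obtains \<alpha> \<beta> where "\<And>u. poly Q u = (\<Prod>v\<in>R. u - v) * (\<alpha> + \<beta> * u)"
proof -
  define Z where "Z = (\<Prod>r\<in>R. [:-r, 1:])"
  obtain L where L: "Q = Z * L"
    using prod_linear_factors_dvd[OF assms(1,3)] unfolding Z_def by (auto elim: dvdE)
  have Z: "Z \<noteq> 0" "degree Z = card R"
    using assms(1) by (auto simp: Z_def degree_prod_eq_sum_degree)
  have "degree L \<le> 1"
  proof (cases "L = 0")
    case False
    then have "degree Q = card R + degree L"
      using Z by (simp add: L degree_mult_eq)
    then show ?thesis using assms(2) by simp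
  qed simp
  then obtain \<alpha> \<beta> where "L = [:\<alpha>, \<beta>:]"
    by (metis degree1_coeffs degree_eq_zeroE le_less less_one pCons_0_0 pCons_eq_0_iff)
  then have "poly Q u = (\<Prod>v\<in>R. u - v) * (\<alpha> + \<beta> * u)" for u
    by (simp add: L Z_def poly_prod algebra_simps)
  then show thesis by (rule that)
qed

lemma sum_Pow_insert:
  assumes "finite R" "u \<notin> R"
  shows "(\<Sum>K\<in>Pow (insert u R). h K) = (\<Sum>K\<in>Pow R. h K + h (insert u K))"
proof -
  have "inj_on (insert u) (Pow R)"
    using assms by (auto intro!: inj_onI)
  moreover have "Pow R \<inter> insert u ` Pow R = {}"
    using assms by auto
  ultimately show ?thesis
    using assms by (simp add: Pow_insert sum.union_disjoint sum.reindex sum.distrib)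
qed

lemma prod_swap_sign:
  fixes r :: "'a::field"
  shows "(\<Prod>p\<in>K. (p - r - 1) / (p - r)) = (\<Prod>p\<in>K. r - p + 1) / (\<Prod>p\<in>K. r - p)"
  unfolding prod_dividef[symmetric]
proof (intro prod.cong refl)
  fix p
  have "p - r - 1 = - (r - p + 1)" "p - r = - (r - p)" by simp_all
  then show "(p - r - 1) / (p - r) = (r - p + 1) / (r - p)"
    by (simp only: minus_divide_divide)
qed

text \<open>
  As a function of one element \<open>u\<close>, the sum is \<open>Q(u) / \<Prod>\<^bsub>v \<in> R\<^esub> (u - v)\<close> for a polynomial \<open>Q\<close> of degree at
  most \<open>|R| + 1\<close>. At \<open>u = r \<in> R\<close> the terms of \<open>Q\<close> cancel in pairs: the term of \<open>L \<union> {r}\<close>, with \<open>u\<close> outside the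
  subset, against the term of \<open>L \<union> {u}\<close>, with \<open>r\<close> outside. Both subsets have the same cardinality, hence
  the same weight, which is why the weights may be arbitrary.
\<close>

lemma subset_sum_affine: "affine_in_each (subset_sum w c d)"
  unfolding affine_in_each_def
proof (intro allI impI)
  fix R :: "'a set"
  assume R: "finite R"
  then have fin: "finite K" if "K \<in> Pow R" for K
    using that finite_subset by auto
  define A where "A = (\<lambda>R K. (\<Prod>u\<in>K. \<Prod>v\<in>R - K. (u - v - 1) / (u - v))
    * (\<Prod>u\<in>K. c + u) * (\<Prod>v\<in>R - K. d + v))"
  \<comment> \<open>\<open>P1 K\<close> collects the factors with \<open>u\<close> in the term of \<open>K\<close>, and \<open>P2 K\<close> those in the term of \<open>K \<union> {u}\<close>,
    both multiplied by \<open>\<Prod>\<^bsub>v \<in> R\<^esub> (u - v)\<close>\<close>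
  define P1 where "P1 = (\<lambda>K. [:d, 1:] * (\<Prod>p\<in>K. [:1 - p, 1:]) * (\<Prod>v\<in>R - K. [:-v, 1:]))"
  define P2 where "P2 = (\<lambda>K. [:c, 1:] * (\<Prod>p\<in>K. [:-p, 1:]) * (\<Prod>v\<in>R - K. [:-v - 1, 1:]))"
  define Q where "Q = (\<Sum>K\<in>Pow R. smult (w (card K) * A R K) (P1 K) + smult (w (Suc (card K)) * A R K) (P2 K))"
  have deg: "degree Q \<le> Suc (card R)"
  proof -
    have lin: "degree (\<Prod>k\<in>K. [:f k, 1:]) \<le> card K" for K and f :: "'a \<Rightarrow> 'a"
      using degree_prod_sum_le[of K "\<lambda>k. [:f k, 1:]"] by (cases "finite K") auto
    have "degree ([:e, 1:] * (\<Prod>p\<in>K. [:f p, 1:]) * (\<Prod>v\<in>R - K. [:g v, 1:])) \<le> Suc (card R)"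
      if "K \<in> Pow R" for K e and f g :: "'a \<Rightarrow> 'a"
    proof -
      have "degree ([:e, 1:] * (\<Prod>p\<in>K. [:f p, 1:]) * (\<Prod>v\<in>R - K. [:g v, 1:])) \<le> 1 + card K + card (R - K)"
        using lin[of f K] lin[of g "R - K"]
        by (intro order.trans[OF degree_mult_le] add_mono) auto
      also have "\<dots> = Suc (card R)"
        using that R by (simp add: card_Diff_subset fin card_mono)
      finally show ?thesis .
    qed
    then show ?thesis
      unfolding Q_def P1_def P2_def
      by (intro degree_sum_le degree_add_le order.trans[OF degree_smult_le]) (use R in auto)
  qed
  have root: "poly Q r = 0" if r: "r \<in> R" for r
  proof -
    define R' where "R' = R - {r}"
    have R': "R = insert r R'" "r \<notin> R'" "finite R'"
      using r R by (auto simp: R'_def)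
    define h where "h = (\<lambda>K. w (card K) * A R K * poly (P1 K) r + w (Suc (card K)) * A R K * poly (P2 K) r)"
    have "h L + h (insert r L) = 0" if L: "L \<in> Pow R'" for L
    proof -
      have fL: "finite L" "r \<notin> L" "finite (R' - L)" "r \<notin> R' - L" using L R' finite_subset by auto
      have diff: "R - L = insert r (R' - L)" "R - insert r L = R' - L"
        using R' fL by auto
      define B where "B = A R' L"
      define X where "X = (\<Prod>p\<in>L. r - p + 1)"
      define Y where "Y = (\<Prod>v\<in>R' - L. r - v - 1)"
      define Z where "Z = (\<Prod>p\<in>L. r - p)"
      define W where "W = (\<Prod>v\<in>R' - L. r - v)"
      have nz: "Z \<noteq> 0" "W \<noteq> 0"
        using fL by (auto simp: Z_def W_def)
      have a1: "A R L = B * (X / Z) * (d + r)"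
      proof -
        have "(\<Prod>p\<in>L. (p - r - 1) / (p - r)) = X / Z"
          unfolding X_def Z_def by (rule prod_swap_sign)
        then have "(\<Prod>p\<in>L. \<Prod>v\<in>insert r (R' - L). (p - v - 1) / (p - v))
            = (X / Z) * (\<Prod>p\<in>L. \<Prod>v\<in>R' - L. (p - v - 1) / (p - v))"
          by (simp only: prod.insert[OF fL(3,4)] prod.distrib)
        then show ?thesis
          unfolding A_def B_def diff prod.insert[OF fL(3,4)] by (simp only: mult_ac)
      qed
      have a2: "A R (insert r L) = B * (Y / W) * (c + r)"
        using fL by (simp add: A_def B_def diff prod_dividef Y_def W_def mult_ac)
      have p: "poly (P1 L) r = 0" "poly (P2 (insert r L)) r = 0"
        "poly (P1 (insert r L)) r = (d + r) * X * W"
        "poly (P2 L) r = (c + r) * Z * (- Y)"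
        using fL by (simp_all add: P1_def P2_def diff poly_prod X_def W_def Z_def Y_def algebra_simps)
      show ?thesis
        using nz fL unfolding h_def a1 a2 p by (simp add: field_simps)
    qed
    then have "(\<Sum>K\<in>Pow R. h K) = 0"
      unfolding R'(1) sum_Pow_insert[OF R'(3,2)] by simp
    then show ?thesis
      by (simp add: Q_def h_def poly_sum)
  qed
  obtain \<alpha> \<beta> where \<alpha>\<beta>: "\<And>u. poly Q u = (\<Prod>v\<in>R. u - v) * (\<alpha> + \<beta> * u)"
    using affine_quotient[OF R deg root] by blast
  have "subset_sum w c d (insert u R) = \<alpha> + \<beta> * u" if u: "u \<notin> R" for u
  proof -
    have nz: "(\<Prod>v\<in>R. u - v) \<noteq> 0" using u R by auto
    have "subset_sum w c d (insert u R) =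
      (\<Sum>K\<in>Pow R. (w (card K) * A R K * poly (P1 K) u + w (Suc (card K)) * A R K * poly (P2 K) u)
         / (\<Prod>v\<in>R. u - v))"
      unfolding subset_sum_def sum_Pow_insert[OF R u]
    proof (intro sum.cong refl)
      fix K assume K: "K \<in> Pow R"
      have fK: "finite K" "u \<notin> K" "finite (R - K)" "u \<notin> R - K" using K u R fin by auto
      have diff: "insert u R - K = insert u (R - K)" "insert u R - insert u K = R - K"
        using u fK by auto
      define X where "X = (\<Prod>p\<in>K. u - p + 1)"
      define Y where "Y = (\<Prod>v\<in>R - K. u - v - 1)"
      define Z where "Z = (\<Prod>p\<in>K. u - p)"
      define W where "W = (\<Prod>v\<in>R - K. u - v)"
      have nz: "Z \<noteq> 0" "W \<noteq> 0"
        using fK by (auto simp: Z_def W_def)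
      have ZW: "(\<Prod>v\<in>R. u - v) = Z * W"
        unfolding Z_def W_def using prod.subset_diff[of K R "\<lambda>v. u - v"] K R by (simp add: mult.commute)
      have 1: "(\<Prod>p\<in>K. (p - u - 1) / (p - u)) = X / Z"
          unfolding X_def Z_def by (rule prod_swap_sign)
      have 2: "(\<Prod>v\<in>R - K. (u - v - 1) / (u - v)) = Y / W"
        by (simp add: prod_dividef Y_def W_def)
      have 3: "(\<Prod>p\<in>K. \<Prod>v\<in>insert u (R - K). (p - v - 1) / (p - v))
          = (X / Z) * (\<Prod>p\<in>K. \<Prod>v\<in>R - K. (p - v - 1) / (p - v))"
        by (simp only: prod.insert[OF fK(3,4)] prod.distrib 1)
      have p: "poly (P1 K) u = (d + u) * X * W" "poly (P2 K) u = (c + u) * Z * Y"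
        by (simp_all add: P1_def P2_def poly_prod X_def W_def Z_def Y_def algebra_simps)
      show "w (card K) * (\<Prod>p\<in>K. \<Prod>v\<in>insert u R - K. (p - v - 1) / (p - v))
          * (\<Prod>p\<in>K. c + p) * (\<Prod>v\<in>insert u R - K. d + v) +
        w (card (insert u K)) * (\<Prod>p\<in>insert u K. \<Prod>v\<in>insert u R - insert u K. (p - v - 1) / (p - v))
          * (\<Prod>p\<in>insert u K. c + p) * (\<Prod>v\<in>insert u R - insert u K. d + v) =
        (w (card K) * A R K * poly (P1 K) u + w (Suc (card K)) * A R K * poly (P2 K) u) / (\<Prod>v\<in>R. u - v)"
        unfolding p ZW diff A_def 3
        unfolding prod.insert[OF fK(1,2)] prod.insert[OF fK(3,4)]
          card_insert_disjoint[OF fK(1,2)] 2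
        using nz by (simp add: field_simps)
    qed
    also have "\<dots> = poly Q u / (\<Prod>v\<in>R. u - v)"
      by (simp add: Q_def poly_sum sum_divide_distrib)
    also have "\<dots> = \<alpha> + \<beta> * u" using nz by (simp add: \<alpha>\<beta>)
    finally show ?thesis .
  qed
  then show "\<exists>\<alpha> \<beta>. \<forall>u. u \<notin> R \<longrightarrow> subset_sum w c d (insert u R) = \<alpha> + \<beta> * u" by blast
qed

lemma affine_in_each_diff:
  assumes "affine_in_each f" "affine_in_each g"
  shows "affine_in_each (\<lambda>S. f S - g S)"
  unfolding affine_in_each_def
proof (intro allI impI)
  fix R :: "'a set" assume "finite R"
  with assms obtain \<alpha> \<beta> \<alpha>' \<beta>' where
    "\<forall>u. u \<notin> R \<longrightarrow> f (insert u R) = \<alpha> + \<beta> * u" "\<forall>u. u \<notin> R \<longrightarrow> g (insert u R) = \<alpha>' + \<beta>' * u"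
    unfolding affine_in_each_def by meson
  then have "\<forall>u. u \<notin> R \<longrightarrow> f (insert u R) - g (insert u R) = (\<alpha> - \<alpha>') + (\<beta> - \<beta>') * u"
    by (simp add: algebra_simps)
  then show "\<exists>\<alpha> \<beta>. \<forall>u. u \<notin> R \<longrightarrow> f (insert u R) - g (insert u R) = \<alpha> + \<beta> * u" by blast
qed

lemma affine_in_each_reflect:
  assumes "affine_in_each f"
  shows "affine_in_each (\<lambda>S. f ((\<lambda>u. a - u) ` S))"
  unfolding affine_in_each_def
proof (intro allI impI)
  fix R :: "'a set" assume "finite R"
  then have "finite ((\<lambda>u. a - u) ` R)" by simp
  then obtain \<alpha> \<beta> where
    *: "u \<notin> (\<lambda>u. a - u) ` R \<Longrightarrow> f (insert u ((\<lambda>u. a - u) ` R)) = \<alpha> + \<beta> * u" for u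
    using assms unfolding affine_in_each_def by meson
  have "f ((\<lambda>u. a - u) ` insert u R) = (\<alpha> + \<beta> * a) + (- \<beta>) * u" if "u \<notin> R" for u
  proof -
    have "a - u \<notin> (\<lambda>u. a - u) ` R" using that by auto
    from *[OF this] show ?thesis by (simp add: algebra_simps)
  qed
  then show "\<exists>\<alpha> \<beta>. \<forall>u. u \<notin> R \<longrightarrow> f ((\<lambda>u. a - u) ` insert u R) = \<alpha> + \<beta> * u" by blast
qed

text \<open>
  Start from a chain disjoint from \<open>S\<close> and exchange its elements one by one for elements of \<open>S\<close>. If \<open>R\<close>
  consists of \<open>k\<close> elements of \<open>S\<close> and of \<open>N - 1 - k\<close> consecutive elements of the chain, then it can be
  completed by the next chain element at the lower end or at the upper end, and both completions are known to
  give \<open>0\<close>. An affine function with two zeros vanishes, so any other element of \<open>S\<close> may be put in instead.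
\<close>

lemma affine_in_each_zero_if_zero_on_chains:
  fixes f :: "'a::field_char_0 set \<Rightarrow> 'a"
  assumes aff: "affine_in_each f"
    and chain: "\<And>z. f ((\<lambda>k. z + of_nat k) ` {..<N}) = 0"
    and S: "finite S" "card S = N"
  shows "f S = 0"
proof -
  \<comment> \<open>each exchange may shift the chain by one, so all \<open>z + k\<close> with \<open>k \<le> 2 N\<close> have to avoid \<open>S\<close>\<close>
  have "finite ((\<lambda>(s, k). s - of_nat k) ` (S \<times> {..2 * N}))"
    using S by simp
  then obtain z where "z \<notin> (\<lambda>(s, k). s - of_nat k) ` (S \<times> {..2 * N})"
    using ex_new_if_finite infinite_UNIV_char_0 by blast
  then have z: "z + of_nat k \<notin> S" if "k \<le> 2 * N" for k
    using that by (force simp: image_iff)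
  let ?C = "\<lambda>a b. (\<lambda>k. z + of_nat k) ` {a..<b}"
  have "f (U \<union> ?C (j + k) (j + N)) = 0"
    if "U \<subseteq> S" "card U = k" "k \<le> N" "j + k \<le> N" for U j k
    using that
  proof (induction k arbitrary: U j)
    case 0
    then have "U = {}" using S finite_subset by fastforce
    moreover have "?C j (j + N) = (\<lambda>k. (z + of_nat j) + of_nat k) ` {..<N}"
    proof -
      have "{j..<j + N} = (\<lambda>k. j + k) ` {..<N}"
        by (simp add: lessThan_atLeast0 add.commute)
      then show ?thesis by (simp add: image_image add.assoc)
    qed
    ultimately show ?case using chain[of "z + of_nat j"] by simp
  next
    case (Suc k)
    then obtain u V where V: "U = insert u V" "u \<notin> V" "card V = k"
      by (metis card_Suc_eq)
    define R where "R = V \<union> ?C (j + Suc k) (j + N)"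
    have "finite R" using V Suc.prems S finite_subset by (auto simp: R_def)
    then obtain \<alpha> \<beta> where *: "\<And>v. v \<notin> R \<Longrightarrow> f (insert v R) = \<alpha> + \<beta> * v"
      using aff unfolding affine_in_each_def by meson
    have notin: "z + of_nat i \<notin> R" if "i = j + k \<or> i = j + N" for i
      using z[of i] that Suc.prems V by (auto simp: R_def simp del: of_nat_add)
    have "insert (z + of_nat (j + k)) R = V \<union> ?C (j + k) (j + N)"
    proof -
      have "{j + k..<j + N} = insert (j + k) {j + Suc k..<j + N}" using Suc.prems by auto
      then show ?thesis by (simp add: R_def)
    qed
    then have 1: "\<alpha> + \<beta> * (z + of_nat (j + k)) = 0"
      using Suc.IH[of V j] *[OF notin, of "j + k"] V Suc.prems by simp
    have "insert (z + of_nat (j + N)) R = V \<union> ?C (Suc j + k) (Suc j + N)"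
    proof -
      have "{Suc j + k..<Suc j + N} = insert (j + N) {j + Suc k..<j + N}" using Suc.prems by auto
      then show ?thesis by (simp add: R_def)
    qed
    then have 2: "\<alpha> + \<beta> * (z + of_nat (j + N)) = 0"
      using Suc.IH[of V "Suc j"] *[OF notin, of "j + N"] V Suc.prems by simp
    have "\<beta> * (of_nat (j + N) - of_nat (j + k)) = 0"
    proof -
      have "\<beta> * (of_nat (j + N) - of_nat (j + k))
          = (\<alpha> + \<beta> * (z + of_nat (j + N))) - (\<alpha> + \<beta> * (z + of_nat (j + k)))"
        by (simp add: algebra_simps)
      then show ?thesis unfolding 1 2 by simp
    qed
    then have "\<beta> = 0"
      using Suc.prems by (metis add_left_cancel eq_iff_diff_eq_0 mult_eq_0_iff not_less_eq_eq of_nat_eq_iff order_refl)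
    then have "\<alpha> = 0" using 1 by simp
    have "u \<notin> R"
    proof -
      have "u \<in> S" using V Suc.prems by auto
      moreover have "z + of_nat i \<notin> S" if "i < j + N" for i
        using z[of i] that Suc.prems by simp
      ultimately show ?thesis using V by (force simp: R_def)
    qed
    then have "f (insert u R) = 0" using * \<open>\<alpha> = 0\<close> \<open>\<beta> = 0\<close> by simp
    then show ?case by (simp add: R_def V)
  qed
  from this[of S N 0] S show ?thesis by simp
qed

section \<open>Subset sums over unions of blocks\<close>

definition blocks :: "'i set \<Rightarrow> ('i \<Rightarrow> 'a::field_char_0) \<Rightarrow> ('i \<Rightarrow> nat) \<Rightarrow> 'a set" where
  "blocks I x m = (\<lambda>(i, k). x i + of_nat k) ` (SIGMA i:I. {..<m i})"

text \<open>
  The bound is \<open>k \<le> m i\<close> and not \<open>k < m i\<close>: blocks must be disjoint and not even adjacent, because the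
  product of the ratios between two blocks telescopes to a quotient that may degenerate to \<open>0 / 0\<close> for
  adjacent ones.
\<close>

definition separated :: "'i set \<Rightarrow> ('i \<Rightarrow> 'a::field_char_0) \<Rightarrow> ('i \<Rightarrow> nat) \<Rightarrow> bool" where
  "separated I x m \<longleftrightarrow> (\<forall>i\<in>I. \<forall>j\<in>I. i \<noteq> j \<longrightarrow> (\<forall>k\<le>m i. x j \<noteq> x i + of_nat k))"

lemma separatedD:
  assumes "separated I x m" "i \<in> I" "j \<in> I" "k \<le> m i" "l \<le> m j" "x i + of_nat k = x j + of_nat l"
  shows "i = j \<and> k = l"
proof (cases "i = j")
  case True
  with assms(6) show ?thesis by simp
next
  case False
  show ?thesis
  proof (cases "l \<le> k")
    case True
    then have "x j = x i + of_nat (k - l)"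
      using assms(6) by (simp add: of_nat_diff algebra_simps)
    moreover have "k - l \<le> m i" using assms(4) by simp
    ultimately show ?thesis
      using assms(1)[unfolded separated_def, rule_format, OF assms(2,3) False] by blast
  next
    assume "\<not> l \<le> k"
    then have "x i = x j + of_nat (l - k)"
      using assms(6) by (simp add: of_nat_diff algebra_simps)
    moreover have "l - k \<le> m j" using assms(5) by simp
    ultimately show ?thesis
      using assms(1)[unfolded separated_def, rule_format, OF assms(3,2) False[symmetric]] by blast
  qed
qed

lemma separated_inj_on:
  assumes "separated I x m"
  shows "inj_on (\<lambda>(i, k). x i + of_nat k) (SIGMA i:I. {..m i})"
  using separatedD[OF assms] by (force intro!: inj_onI)

lemma mem_blocks_iff:
  assumes "separated I x m" "\<forall>i\<in>I. \<gamma> i \<le> m i" "i \<in> I" "k \<le> m i"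
  shows "x i + of_nat k \<in> blocks I x \<gamma> \<longleftrightarrow> k < \<gamma> i"
proof
  assume "x i + of_nat k \<in> blocks I x \<gamma>"
  then obtain j l where "j \<in> I" "l < \<gamma> j" "x i + of_nat k = x j + of_nat l"
    by (auto simp: blocks_def)
  moreover from this have "l \<le> m j" using assms(2) by fastforce
  ultimately have "i = j \<and> k = l"
    using separatedD[OF assms(1,3) _ assms(4)] by blast
  then show "k < \<gamma> i" using \<open>l < \<gamma> j\<close> by simp
qed (use assms(3) in \<open>force simp: blocks_def\<close>)

lemma blocks_diff:
  assumes "separated I x m" "\<forall>i\<in>I. \<gamma> i \<le> m i"
  shows "blocks I x m - blocks I x \<gamma> = (\<lambda>(i, k). x i + of_nat k) ` (SIGMA i:I. {\<gamma> i..<m i})"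
    (is "_ = ?f ` ?A")
proof (intro set_eqI iffI)
  fix v assume v: "v \<in> blocks I x m - blocks I x \<gamma>"
  then obtain i k where ik: "i \<in> I" "k < m i" "v = x i + of_nat k"
    by (auto simp: blocks_def)
  then have "\<not> k < \<gamma> i" using v mem_blocks_iff[OF assms, of i k] by simp
  then show "v \<in> ?f ` ?A" using ik by force
next
  fix v assume "v \<in> ?f ` ?A"
  then obtain i k where ik: "i \<in> I" "\<gamma> i \<le> k" "k < m i" "v = x i + of_nat k" by auto
  then show "v \<in> blocks I x m - blocks I x \<gamma>"
    using mem_blocks_iff[OF assms, of i k] by (auto simp: blocks_def)
qed

lemma prod_image_Sigma:
  assumes "separated I x m" "finite I" "\<forall>i\<in>I. A i \<subseteq> {..m i}"
  shows "(\<Prod>u\<in>(\<lambda>(i, k). x i + of_nat k) ` (SIGMA i:I. A i). h u) = (\<Prod>i\<in>I. \<Prod>k\<in>A i. h (x i + of_nat k))"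
proof -
  have "inj_on (\<lambda>(i, k). x i + of_nat k) (SIGMA i:I. A i)"
    by (rule inj_on_subset[OF separated_inj_on[OF assms(1)]]) (use assms(3) in auto)
  moreover have "\<forall>i\<in>I. finite (A i)"
    using assms(3) finite_subset by blast
  ultimately show ?thesis
    using assms(2) by (simp add: prod.reindex prod.Sigma comp_def case_prod_unfold)
qed

lemma prod_blocks:
  assumes "separated I x m" "finite I" "\<forall>i\<in>I. \<gamma> i \<le> m i"
  shows "(\<Prod>u\<in>blocks I x \<gamma>. h u) = (\<Prod>i\<in>I. \<Prod>k<\<gamma> i. h (x i + of_nat k))"
  unfolding blocks_def
  by (rule prod_image_Sigma[OF assms(1,2)]) (use assms(3) in fastforce)

lemma prod_blocks_diff:
  assumes "separated I x m" "finite I" "\<forall>i\<in>I. \<gamma> i \<le> m i"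
  shows "(\<Prod>v\<in>blocks I x m - blocks I x \<gamma>. h v) = (\<Prod>i\<in>I. \<Prod>k\<in>{\<gamma> i..<m i}. h (x i + of_nat k))"
  unfolding blocks_diff[OF assms(1,3)]
  by (rule prod_image_Sigma[OF assms(1,2)]) auto

lemma card_blocks:
  assumes "separated I x m" "finite I" "\<forall>i\<in>I. \<gamma> i \<le> m i"
  shows "card (blocks I x \<gamma>) = (\<Sum>i\<in>I. \<gamma> i)"
proof -
  have "inj_on (\<lambda>(i, k). x i + of_nat k) (SIGMA i:I. {..<\<gamma> i})"
    by (rule inj_on_subset[OF separated_inj_on[OF assms(1)]]) (use assms(3) in force)
  then show ?thesis
    using assms(2) by (simp add: blocks_def card_image)
qed

lemma prod_telescope_ratio:
  fixes y :: "'a::field_char_0"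
  assumes "g \<le> m" "\<And>l. g \<le> l \<Longrightarrow> l \<le> m \<Longrightarrow> y \<noteq> of_nat l"
  shows "(\<Prod>l\<in>{g..<m}. (y - of_nat l - 1) / (y - of_nat l)) = (y - of_nat m) / (y - of_nat g)"
  using assms
proof (induction m rule: dec_induct)
  case base
  then show ?case by simp
next
  case (step m)
  have "y \<noteq> of_nat m" "y \<noteq> of_nat g" using step.prems[of m] step.prems[of g] step.hyps by auto
  moreover have "(\<Prod>l\<in>{g..<m}. (y - of_nat l - 1) / (y - of_nat l)) = (y - of_nat m) / (y - of_nat g)"
    using step by simp
  moreover have "(\<Prod>l\<in>{g..<Suc m}. (y - of_nat l - 1) / (y - of_nat l))
      = (\<Prod>l\<in>{g..<m}. (y - of_nat l - 1) / (y - of_nat l)) * ((y - of_nat m - 1) / (y - of_nat m))"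
    using step.hyps by simp
  ultimately show ?case
    by (simp only: of_nat_Suc) (simp add: divide_simps)
qed

lemma pochhammer_eq_prod: "pochhammer a n = (\<Prod>k<n. a + of_nat k)"
  by (simp add: pochhammer_prod lessThan_atLeast0)

lemma blocks_interaction:
  assumes sep: "separated I x m" and fin: "finite I" and \<gamma>: "\<forall>i\<in>I. \<gamma> i \<le> m i"
  shows "(\<Prod>u\<in>blocks I x \<gamma>. \<Prod>v\<in>blocks I x m - blocks I x \<gamma>. (u - v - 1) / (u - v))
    = (\<Prod>i\<in>I. \<Prod>j\<in>I. pochhammer (x i - x j - of_nat (m j)) (\<gamma> i)
                        / pochhammer (x i - x j - of_nat (\<gamma> j)) (\<gamma> i))"
proof -
  have "(\<Prod>u\<in>blocks I x \<gamma>. \<Prod>v\<in>blocks I x m - blocks I x \<gamma>. (u - v - 1) / (u - v))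
      = (\<Prod>i\<in>I. \<Prod>k<\<gamma> i. \<Prod>j\<in>I. \<Prod>l\<in>{\<gamma> j..<m j}.
          (x i + of_nat k - (x j + of_nat l) - 1) / (x i + of_nat k - (x j + of_nat l)))"
    by (simp only: prod_blocks[OF sep fin \<gamma>] prod_blocks_diff[OF sep fin \<gamma>])
  also have "\<dots> = (\<Prod>i\<in>I. \<Prod>k<\<gamma> i. \<Prod>j\<in>I.
      (x i - x j - of_nat (m j) + of_nat k) / (x i - x j - of_nat (\<gamma> j) + of_nat k))"
  proof (intro prod.cong refl)
    fix i k j assume i: "i \<in> I" and k: "k \<in> {..<\<gamma> i}" and j: "j \<in> I"
    define y where "y = x i - x j + of_nat k"
    have ne: "y \<noteq> of_nat l" if "\<gamma> j \<le> l" "l \<le> m j" for l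
    proof
      assume "y = of_nat l"
      then have "x i + of_nat k = x j + of_nat l" by (simp add: y_def algebra_simps)
      moreover have "k \<le> m i" using k \<gamma>[rule_format, OF i] by simp
      ultimately have "i = j \<and> k = l"
        using separatedD[OF sep i j] that by blast
      then show False using k that by simp
    qed
    have "(\<Prod>l\<in>{\<gamma> j..<m j}. (x i + of_nat k - (x j + of_nat l) - 1) / (x i + of_nat k - (x j + of_nat l)))
        = (\<Prod>l\<in>{\<gamma> j..<m j}. (y - of_nat l - 1) / (y - of_nat l))"
      by (simp add: y_def algebra_simps)
    also have "\<dots> = (y - of_nat (m j)) / (y - of_nat (\<gamma> j))"
      by (rule prod_telescope_ratio[OF \<gamma>[rule_format, OF j] ne])
    finally show "(\<Prod>l\<in>{\<gamma> j..<m j}. (x i + of_nat k - (x j + of_nat l) - 1) / (x i + of_nat k - (x j + of_nat l)))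
        = (x i - x j - of_nat (m j) + of_nat k) / (x i - x j - of_nat (\<gamma> j) + of_nat k)"
      by (simp add: y_def algebra_simps)
  qed
  also have "\<dots> = (\<Prod>i\<in>I. \<Prod>j\<in>I. \<Prod>k<\<gamma> i.
      (x i - x j - of_nat (m j) + of_nat k) / (x i - x j - of_nat (\<gamma> j) + of_nat k))"
    by (intro prod.cong refl prod.swap)
  finally show ?thesis
    by (simp add: pochhammer_eq_prod prod_dividef)
qed

text \<open>
  The subsets that survive in the subset sum: the factor of \<open>u \<in> K\<close> and \<open>v \<in> S - K\<close> with \<open>u = v + 1\<close> is \<open>0\<close>.
  A set of indices of one block that contains with \<open>k + 1\<close> also \<open>k\<close> is an initial segment.
\<close>

lemma blocks_of_predecessor_closed:
  assumes K: "K \<subseteq> blocks I x m" and closed: "\<And>u v. u \<in> K \<Longrightarrow> v \<in> blocks I x m - K \<Longrightarrow> u \<noteq> v + 1"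
  shows "K \<in> blocks I x ` (\<Pi>\<^sub>E i\<in>I. {..m i})"
proof -
  define D where "D = (\<lambda>i. {k. k < m i \<and> x i + of_nat k \<in> K})"
  define \<gamma> where "\<gamma> = (\<lambda>i\<in>I. LEAST k. k \<notin> D i)"
  have D: "D i = {..<\<gamma> i}" if i: "i \<in> I" for i
  proof -
    have "m i \<notin> D i" by (simp add: D_def)
    have \<gamma>i: "\<gamma> i = (LEAST k. k \<notin> D i)" using i by (simp add: \<gamma>_def)
    have "\<gamma> i \<notin> D i"
      unfolding \<gamma>i by (rule LeastI[of "\<lambda>k. k \<notin> D i"]) fact
    have below: "k \<in> D i" if "k < \<gamma> i" for k
      using not_less_Least[OF that[unfolded \<gamma>i]] by simp
    have pred: "k \<in> D i" if "Suc k \<in> D i" for k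
    proof (rule ccontr)
      assume "k \<notin> D i"
      moreover have "k < m i" using that by (simp add: D_def)
      ultimately have "x i + of_nat k \<in> blocks I x m - K"
        using i unfolding D_def blocks_def by (auto intro!: image_eqI[of _ _ "(i, k)"])
      moreover have "x i + of_nat (Suc k) \<in> K" using that by (simp add: D_def)
      ultimately show False using closed[of "x i + of_nat (Suc k)" "x i + of_nat k"] by simp
    qed
    have "k \<notin> D i" if "\<gamma> i \<le> k" for k
      using that \<open>\<gamma> i \<notin> D i\<close> pred by (induction rule: dec_induct) auto
    with below show ?thesis by (auto simp: not_less[symmetric])
  qed
  have "\<gamma> i \<le> m i" if "i \<in> I" for i
  proof -
    have "m i \<notin> {..<\<gamma> i}" unfolding D[OF that, symmetric] by (simp add: D_def)
    then show ?thesis by simp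
  qed
  then have "\<gamma> \<in> (\<Pi>\<^sub>E i\<in>I. {..m i})" by (auto simp: \<gamma>_def)
  moreover have "K = blocks I x \<gamma>"
  proof (intro set_eqI iffI)
    fix u assume "u \<in> K"
    with K obtain i k where "i \<in> I" "k < m i" "u = x i + of_nat k" by (auto simp: blocks_def)
    moreover from this \<open>u \<in> K\<close> have "k \<in> D i" by (simp add: D_def)
    ultimately show "u \<in> blocks I x \<gamma>" using D by (force simp: blocks_def)
  next
    fix u assume "u \<in> blocks I x \<gamma>"
    then obtain i k where "i \<in> I" "k < \<gamma> i" "u = x i + of_nat k" by (auto simp: blocks_def)
    moreover from this have "k \<in> D i" using D by auto
    ultimately show "u \<in> K" by (simp add: D_def)
  qed
  ultimately show ?thesis by blast
qed

text \<open>
  The link between subsets and multi-indices: the multi-index \<open>\<gamma>\<close> stands for the union of the initial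
  segments of lengths \<open>\<gamma> i\<close> of the blocks.
\<close>

lemma subset_sum_blocks:
  assumes sep: "separated I x m" and fin: "finite I"
  shows "subset_sum w c d (blocks I x m) =
    (\<Sum>\<gamma>\<in>(\<Pi>\<^sub>E i\<in>I. {..m i}). w (\<Sum>i\<in>I. \<gamma> i)
       * (\<Prod>i\<in>I. \<Prod>j\<in>I. pochhammer (x i - x j - of_nat (m j)) (\<gamma> i)
                        / pochhammer (x i - x j - of_nat (\<gamma> j)) (\<gamma> i))
       * (\<Prod>i\<in>I. pochhammer (c + x i) (\<gamma> i))
       * (\<Prod>i\<in>I. pochhammer (d + x i + of_nat (\<gamma> i)) (m i - \<gamma> i)))"
proof -
  let ?S = "blocks I x m"
  let ?P = "\<Pi>\<^sub>E i\<in>I. {..m i}"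
  define T where "T = (\<lambda>K. w (card K) * (\<Prod>u\<in>K. \<Prod>v\<in>?S - K. (u - v - 1) / (u - v))
        * (\<Prod>u\<in>K. c + u) * (\<Prod>v\<in>?S - K. d + v))"
  have finS: "finite ?S" using fin by (simp add: blocks_def)
  have le: "\<forall>i\<in>I. \<gamma> i \<le> m i" if "\<gamma> \<in> ?P" for \<gamma> using that by (auto simp: PiE_iff)
  have inj: "inj_on (blocks I x) ?P"
  proof (rule inj_onI)
    fix \<gamma> \<delta> assume \<gamma>: "\<gamma> \<in> ?P" and \<delta>: "\<delta> \<in> ?P" and eq: "blocks I x \<gamma> = blocks I x \<delta>"
    show "\<gamma> = \<delta>"
    proof (rule PiE_ext[OF \<gamma> \<delta>])
      fix i assume i: "i \<in> I"
      have "k < \<gamma> i \<longleftrightarrow> k < \<delta> i" if "k \<le> m i" for k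
        using mem_blocks_iff[OF sep le[OF \<gamma>] i that] mem_blocks_iff[OF sep le[OF \<delta>] i that] eq by simp
      then show "\<gamma> i = \<delta> i"
        using le[OF \<gamma>, rule_format, OF i] le[OF \<delta>, rule_format, OF i] by (metis less_irrefl nat_neq_iff)
    qed
  qed
  have "subset_sum w c d ?S = (\<Sum>K\<in>Pow ?S. T K)"
    by (simp add: subset_sum_def T_def)
  also have "\<dots> = (\<Sum>K\<in>blocks I x ` ?P. T K)"
  proof (rule sum.mono_neutral_right)
    show "blocks I x ` ?P \<subseteq> Pow ?S"
    proof
      fix K assume "K \<in> blocks I x ` ?P"
      then obtain \<gamma> where "\<gamma> \<in> ?P" "K = blocks I x \<gamma>" by blast
      then show "K \<in> Pow ?S"
        using le[of \<gamma>] unfolding blocks_def by (auto intro!: imageI dest: less_le_trans)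
    qed
    show "\<forall>K\<in>Pow ?S - blocks I x ` ?P. T K = 0"
    proof
      fix K assume K: "K \<in> Pow ?S - blocks I x ` ?P"
      then obtain u v where uv: "u \<in> K" "v \<in> ?S - K" "u = v + 1"
        using blocks_of_predecessor_closed[of K I x m] by blast
      have "finite K" using K finS finite_subset by auto
      have "(u - v - 1) / (u - v) = 0" using uv by simp
      then have "(\<Prod>v\<in>?S - K. (u - v - 1) / (u - v)) = 0"
        using uv finS by (intro prod_zero) blast+
      then have "(\<Prod>u\<in>K. \<Prod>v\<in>?S - K. (u - v - 1) / (u - v)) = 0"
        using uv \<open>finite K\<close> by (intro prod_zero) blast+
      then show "T K = 0" by (simp add: T_def)
    qed
  qed (use finS in simp)
  also have "\<dots> = (\<Sum>\<gamma>\<in>?P. T (blocks I x \<gamma>))"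
    by (simp add: sum.reindex[OF inj])
  also have "\<dots> = (\<Sum>\<gamma>\<in>?P. w (\<Sum>i\<in>I. \<gamma> i)
       * (\<Prod>i\<in>I. \<Prod>j\<in>I. pochhammer (x i - x j - of_nat (m j)) (\<gamma> i)
                        / pochhammer (x i - x j - of_nat (\<gamma> j)) (\<gamma> i))
       * (\<Prod>i\<in>I. pochhammer (c + x i) (\<gamma> i))
       * (\<Prod>i\<in>I. pochhammer (d + x i + of_nat (\<gamma> i)) (m i - \<gamma> i)))"
  proof (intro sum.cong refl)
    fix \<gamma> assume \<gamma>: "\<gamma> \<in> ?P"
    note le\<gamma> = le[OF \<gamma>]
    have c: "(\<Prod>u\<in>blocks I x \<gamma>. c + u) = (\<Prod>i\<in>I. pochhammer (c + x i) (\<gamma> i))"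
      by (simp add: prod_blocks[OF sep fin le\<gamma>] pochhammer_eq_prod add.assoc)
    have "(\<Prod>v\<in>?S - blocks I x \<gamma>. d + v) = (\<Prod>i\<in>I. \<Prod>k\<in>{\<gamma> i..<m i}. d + (x i + of_nat k))"
      by (rule prod_blocks_diff[OF sep fin le\<gamma>])
    also have "\<dots> = (\<Prod>i\<in>I. pochhammer (d + x i + of_nat (\<gamma> i)) (m i - \<gamma> i))"
    proof (intro prod.cong refl)
      fix i
      show "(\<Prod>k\<in>{\<gamma> i..<m i}. d + (x i + of_nat k)) = pochhammer (d + x i + of_nat (\<gamma> i)) (m i - \<gamma> i)"
        unfolding pochhammer_eq_prod
        by (rule prod.reindex_bij_witness[of _ "\<lambda>k. k + \<gamma> i" "\<lambda>k. k - \<gamma> i"])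
           (auto simp: of_nat_diff algebra_simps)
    qed
    finally show "T (blocks I x \<gamma>) = w (\<Sum>i\<in>I. \<gamma> i)
       * (\<Prod>i\<in>I. \<Prod>j\<in>I. pochhammer (x i - x j - of_nat (m j)) (\<gamma> i)
                        / pochhammer (x i - x j - of_nat (\<gamma> j)) (\<gamma> i))
       * (\<Prod>i\<in>I. pochhammer (c + x i) (\<gamma> i))
       * (\<Prod>i\<in>I. pochhammer (d + x i + of_nat (\<gamma> i)) (m i - \<gamma> i))"
      unfolding T_def card_blocks[OF sep fin le\<gamma>] blocks_interaction[OF sep fin le\<gamma>] c by simp
  qed
  finally show ?thesis .
qed

lemma blocks_singleton: "blocks {()} (\<lambda>_. z) (\<lambda>_. N) = (\<lambda>k. z + of_nat k) ` {..<N}"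
  by (auto simp: blocks_def)

text \<open>The case of a single block.\<close>

lemma subset_sum_chain:
  "subset_sum w c d ((\<lambda>k. z + of_nat k) ` {..<N}) =
    (\<Sum>k\<le>N. w k * of_nat (N choose k) * pochhammer (c + z) k * pochhammer (d + z + of_nat k) (N - k))"
proof -
  let ?x = "\<lambda>_::unit. z"
  let ?m = "\<lambda>_::unit. N"
  have "separated {()} ?x ?m" by (simp add: separated_def)
  moreover have "blocks {()} ?x ?m = (\<lambda>k. z + of_nat k) ` {..<N}"
    by (rule blocks_singleton)
  moreover have "(\<Pi>\<^sub>E i\<in>{()}. {..N}) = (\<lambda>k _. k) ` {..N}"
    by (auto simp: PiE_over_singleton_iff fun_eq_iff image_iff restrict_def)
  moreover have "inj_on (\<lambda>k _::unit. k) {..N}" by (auto simp: inj_on_def fun_eq_iff)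
  ultimately have "subset_sum w c d ((\<lambda>k. z + of_nat k) ` {..<N}) =
      (\<Sum>k\<le>N. w k * (pochhammer (- of_nat N) k / pochhammer (- of_nat k) k)
         * pochhammer (c + z) k * pochhammer (d + z + of_nat k) (N - k))"
    using subset_sum_blocks[of "{()}" ?x ?m w c d]
    by (simp add: sum.reindex)
  also have "\<dots> = (\<Sum>k\<le>N. w k * of_nat (N choose k)
         * pochhammer (c + z) k * pochhammer (d + z + of_nat k) (N - k))"
  proof (intro sum.cong refl)
    fix k
    have "pochhammer (- of_nat N) k / pochhammer (- of_nat k) k = (of_nat (N choose k) :: 'a)"
      by (cases "even k") (simp_all add: pochhammer_same gbinomial_pochhammer binomial_gbinomial)
    then show "w k * (pochhammer (- of_nat N) k / pochhammer (- of_nat k) k)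
         * pochhammer (c + z) k * pochhammer (d + z + of_nat k) (N - k)
       = w k * of_nat (N choose k) * pochhammer (c + z) k * pochhammer (d + z + of_nat k) (N - k)"
      by (simp only:)
  qed
  finally show ?thesis .
qed

section \<open>The rectangular series as a subset sum\<close>

lemma prod_square_split:
  fixes f :: "nat \<Rightarrow> nat \<Rightarrow> 'a::comm_monoid_mult"
  shows "(\<Prod>i\<in>{1..n}. \<Prod>j\<in>{1..n}. f i j)
    = (\<Prod>i\<in>{1..n}. f i i) * (\<Prod>i\<in>{1..n}. \<Prod>j\<in>{i<..n}. f i j * f j i)"
proof -
  have "(\<Prod>j\<in>{1..n}. f i j) = f i i * ((\<Prod>j\<in>{i<..n}. f i j) * (\<Prod>j\<in>{1..<i}. f i j))"
    if "i \<in> {1..n}" for i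
  proof -
    have "{1..n} = insert i ({i<..n} \<union> {1..<i})" using that by auto
    then have "(\<Prod>j\<in>{1..n}. f i j) = f i i * (\<Prod>j\<in>{i<..n} \<union> {1..<i}. f i j)" by simp
    also have "(\<Prod>j\<in>{i<..n} \<union> {1..<i}. f i j) = (\<Prod>j\<in>{i<..n}. f i j) * (\<Prod>j\<in>{1..<i}. f i j)"
      by (rule prod.union_disjoint) auto
    finally show ?thesis .
  qed
  then have "(\<Prod>i\<in>{1..n}. \<Prod>j\<in>{1..n}. f i j) = (\<Prod>i\<in>{1..n}. f i i)
     * ((\<Prod>i\<in>{1..n}. \<Prod>j\<in>{i<..n}. f i j) * (\<Prod>i\<in>{1..n}. \<Prod>j\<in>{1..<i}. f i j))"
    by (simp add: prod.distrib)
  also have "(\<Prod>i\<in>{1..n}. \<Prod>j\<in>{1..<i}. f i j) = (\<Prod>j\<in>{1..n}. \<Prod>i\<in>{j<..n}. f i j)"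
    unfolding prod.Sigma[OF finite_atLeastAtMost ballI[OF finite_atLeastLessThan]]
      prod.Sigma[OF finite_atLeastAtMost ballI[OF finite_greaterThanAtMost]]
    by (rule prod.reindex_bij_witness[of _ "\<lambda>(i, j). (j, i)" "\<lambda>(i, j). (j, i)"]) auto
  finally show ?thesis by (simp add: prod.distrib)
qed

text \<open>
  Both sides are, up to the sign \<open>(-1)\<^sup>b\<close>, the product of the \<open>a + b + 1\<close> consecutive numbers
  \<open>y - b, \<dots>, y + a\<close>, split at \<open>y + a - b\<close> on the left and at \<open>y\<close> on the right.
\<close>

lemma pochhammer_pair:
  fixes y :: "'a::comm_ring_1"
  shows "(y + of_nat a - of_nat b) * (pochhammer (y - of_nat b) a * pochhammer (- y - of_nat a) b)
       = y * (pochhammer (1 + y) a * pochhammer (1 - y) b)"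
proof -
  have 1: "pochhammer (- y - of_nat a) b = (-1) ^ b * pochhammer (y + of_nat a - of_nat b + 1) b"
    using pochhammer_minus[of "y + of_nat a" b] by simp
  have 2: "pochhammer (1 - y) b = (-1) ^ b * pochhammer (y - of_nat b) b"
    using pochhammer_minus[of "y - 1" b] by simp
  have 3: "pochhammer (y - of_nat b) (a + Suc b)
      = pochhammer (y - of_nat b) a * ((y + of_nat a - of_nat b) * pochhammer (y + of_nat a - of_nat b + 1) b)"
    unfolding pochhammer_product' pochhammer_rec by (simp add: algebra_simps)
  have 4: "pochhammer (y - of_nat b) (b + Suc a)
      = pochhammer (y - of_nat b) b * (y * pochhammer (1 + y) a)"
    unfolding pochhammer_product' pochhammer_rec by (simp add: algebra_simps)
  have "a + Suc b = b + Suc a" by simp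
  then have "pochhammer (y - of_nat b) a * ((y + of_nat a - of_nat b) * pochhammer (y + of_nat a - of_nat b + 1) b)
      = pochhammer (y - of_nat b) b * (y * pochhammer (1 + y) a)"
    unfolding 3[symmetric] 4[symmetric] by (rule arg_cong)
  then have "(-1) ^ b * (pochhammer (y - of_nat b) a * ((y + of_nat a - of_nat b) * pochhammer (y + of_nat a - of_nat b + 1) b))
      = (-1) ^ b * (pochhammer (y - of_nat b) b * (y * pochhammer (1 + y) a))" by simp
  then show ?thesis unfolding 1 2 by (simp only: mult_ac)
qed

text \<open>
  Converts the denominators of the series into those produced by the blocks. The factors of the
  pairs \<open>(i, j)\<close> and \<open>(j, i)\<close> together absorb the factor of the Vandermonde product for \<open>i < j\<close>.
\<close>

lemma Delta_shift:
  "Delta n (\<lambda>i. x i + of_nat (\<gamma> i))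
     * (\<Prod>i\<in>{1..n}. \<Prod>j\<in>{1..n}. pochhammer (x i - x j - of_nat (\<gamma> j)) (\<gamma> i))
   = (-1) ^ size_of n \<gamma> * Delta n x
     * (\<Prod>i\<in>{1..n}. \<Prod>j\<in>{1..n}. pochhammer (1 + x i - x j) (\<gamma> i))"
proof -
  let ?f = "\<lambda>i j. pochhammer (x i - x j - of_nat (\<gamma> j)) (\<gamma> i)"
  let ?g = "\<lambda>i j. pochhammer (1 + x i - x j) (\<gamma> i)"
  have "(\<Prod>i\<in>{1..n}. ?f i i) = (\<Prod>i\<in>{1..n}. (-1) ^ \<gamma> i * ?g i i)"
    by (simp add: pochhammer_same pochhammer_fact)
  then have diag: "(\<Prod>i\<in>{1..n}. ?f i i) = (-1) ^ size_of n \<gamma> * (\<Prod>i\<in>{1..n}. ?g i i)"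
    by (simp add: prod.distrib size_of_def power_sum)
  have pair: "(x i + of_nat (\<gamma> i) - (x j + of_nat (\<gamma> j))) * (?f i j * ?f j i)
      = (x i - x j) * (?g i j * ?g j i)" for i j
  proof -
    have "x i - x j + of_nat (\<gamma> i) - of_nat (\<gamma> j) = x i + of_nat (\<gamma> i) - (x j + of_nat (\<gamma> j))"
      "- (x i - x j) - of_nat (\<gamma> i) = x j - x i - of_nat (\<gamma> i)"
      "1 + (x i - x j) = 1 + x i - x j" "1 - (x i - x j) = 1 + x j - x i"
      by simp_all
    then show ?thesis
      using pochhammer_pair[of "x i - x j" "\<gamma> i" "\<gamma> j"] by (simp only:)
  qed
  have off: "Delta n (\<lambda>i. x i + of_nat (\<gamma> i)) * (\<Prod>i\<in>{1..n}. \<Prod>j\<in>{i<..n}. ?f i j * ?f j i)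
      = Delta n x * (\<Prod>i\<in>{1..n}. \<Prod>j\<in>{i<..n}. ?g i j * ?g j i)"
    unfolding Delta_def prod.distrib[symmetric] pair ..
  have "Delta n (\<lambda>i. x i + of_nat (\<gamma> i)) * (\<Prod>i\<in>{1..n}. \<Prod>j\<in>{1..n}. ?f i j)
      = (-1) ^ size_of n \<gamma> * (\<Prod>i\<in>{1..n}. ?g i i)
        * (Delta n (\<lambda>i. x i + of_nat (\<gamma> i)) * (\<Prod>i\<in>{1..n}. \<Prod>j\<in>{i<..n}. ?f i j * ?f j i))"
    unfolding prod_square_split[of ?f] diag by (simp only: mult_ac)
  also have "\<dots> = (-1) ^ size_of n \<gamma> * Delta n x * (\<Prod>i\<in>{1..n}. \<Prod>j\<in>{1..n}. ?g i j)"
    unfolding off prod_square_split[of ?g] by (simp only: mult_ac)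
  finally show ?thesis .
qed

text \<open>
  The factors depending on \<open>|\<gamma>|\<close> only, after multiplication with \<open>[e\<^sub>1]\<^sub>N [e\<^sub>2]\<^sub>N\<close>; the sign comes from
  \<open>Delta_shift\<close>.
\<close>

definition cleared_weight :: "nat \<Rightarrow> complex \<Rightarrow> complex \<Rightarrow> complex \<Rightarrow> complex \<Rightarrow> nat \<Rightarrow> complex" where
  "cleared_weight N a1 a2 e1 e2 k = (-1) ^ k * pochhammer a1 k * pochhammer a2 k
     * pochhammer (e1 + of_nat k) (N - k) * pochhammer (e2 + of_nat k) (N - k)"

text \<open>
  A coincidence \<open>x\<^sub>j = x\<^sub>i + k\<close> with \<open>k \<le> m\<^sub>i\<close> makes the Vandermonde product vanish if \<open>k = 0\<close>, and
  \<open>[1 + x\<^sub>i - x\<^sub>j]\<^bsub>m\<^sub>i\<^esub>\<close> otherwise.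
\<close>

lemma denominators_nonzero_separated:
  assumes "denominators_nonzero n m ((a1, a2, c, d, e1, e2), x)"
  shows "separated {1..n} x m"
  unfolding separated_def
proof (intro ballI impI allI notI)
  fix i j k assume i: "i \<in> {1..n}" and j: "j \<in> {1..n}" and ij: "i \<noteq> j"
    and k: "k \<le> m i" and eq: "x j = x i + of_nat k"
  have \<Delta>: "Delta n x \<noteq> 0" using assms by simp
  have ne: "x p \<noteq> x q" if "p \<in> {1..n}" "q \<in> {1..n}" "p < q" for p q
  proof
    assume "x p = x q"
    then have "(\<Prod>q\<in>{p<..n}. x p - x q) = 0" using that by (intro prod_zero) auto
    then have "Delta n x = 0" unfolding Delta_def using that by (intro prod_zero) auto
    with \<Delta> show False by simp
  qed
  show False
  proof (cases k)
    case 0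
    then show False using ne[OF i j] ne[OF j i] ij eq by (cases "i < j") auto
  next
    case (Suc l)
    have "restrict m {1..n} \<in> multi_indices n" by (simp add: multi_indices_def)
    then have "pochhammer (1 + x i - x j) (restrict m {1..n} i) \<noteq> 0"
      using assms i j by fastforce
    then have "pochhammer (1 + x i - x j) (m i) \<noteq> 0" using i by simp
    moreover have "1 + x i - x j = - of_nat l" using eq Suc by simp
    moreover have "l < m i" using k Suc by simp
    ultimately show False by (auto simp: pochhammer_eq_0_iff)
  qed
qed

text \<open>
  The prefactor of \<open>F_tilde\<close> clears the remaining denominators: \<open>[e]\<^sub>N / [e]\<^sub>k = [e + k]\<^bsub>N - k\<^esub>\<close>, and likewise
  for \<open>d + x\<^sub>i\<close>, where it leaves the product over the complement of the subset.
\<close>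

lemma F_tilde_eq_subset_sum:
  assumes den: "denominators_nonzero n m ((a1, a2, c, d, e1, e2), x)"
  shows "F_tilde n m ((a1, a2, c, d, e1, e2), x)
    = subset_sum (cleared_weight (size_of n m) a1 a2 e1 e2) c d (blocks {1..n} x m)"
proof -
  let ?I = "{1..n}" and ?N = "size_of n m"
  let ?P = "\<Pi>\<^sub>E i\<in>?I. {..m i}"
  have sep: "separated ?I x m" using den by (rule denominators_nonzero_separated)
  have "F_tilde n m ((a1, a2, c, d, e1, e2), x) =
    (\<Sum>\<gamma>\<in>?P. pochhammer e1 ?N * pochhammer e2 ?N * (\<Prod>i\<in>?I. pochhammer (d + x i) (m i))
       * F_term n m ((a1, a2, c, d, e1, e2), x) \<gamma>)"
    by (simp only: F_tilde.simps F_eq_finite_sum sum_distrib_left)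
  also have "\<dots> = (\<Sum>\<gamma>\<in>?P. cleared_weight ?N a1 a2 e1 e2 (\<Sum>i\<in>?I. \<gamma> i)
       * (\<Prod>i\<in>?I. \<Prod>j\<in>?I. pochhammer (x i - x j - of_nat (m j)) (\<gamma> i)
                        / pochhammer (x i - x j - of_nat (\<gamma> j)) (\<gamma> i))
       * (\<Prod>i\<in>?I. pochhammer (c + x i) (\<gamma> i))
       * (\<Prod>i\<in>?I. pochhammer (d + x i + of_nat (\<gamma> i)) (m i - \<gamma> i)))"
  proof (intro sum.cong refl)
    fix \<gamma> assume \<gamma>: "\<gamma> \<in> ?P"
    have le: "\<gamma> i \<le> m i" if "i \<in> ?I" for i using \<gamma> that by (auto simp: PiE_iff)
    have "\<gamma> \<in> multi_indices n" using \<gamma> by (auto simp: multi_indices_def PiE_iff)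
    with den le have \<Delta>: "Delta n x \<noteq> 0"
      and ij: "\<And>i j. i \<in> ?I \<Longrightarrow> j \<in> ?I \<Longrightarrow> pochhammer (1 + x i - x j) (\<gamma> i) \<noteq> 0"
      and dn: "\<And>i. i \<in> ?I \<Longrightarrow> pochhammer (d + x i) (\<gamma> i) \<noteq> 0"
      and en: "pochhammer e1 (size_of n \<gamma>) \<noteq> 0" "pochhammer e2 (size_of n \<gamma>) \<noteq> 0"
      by auto
    define k where "k = size_of n \<gamma>"
    have kN: "k \<le> ?N" unfolding k_def size_of_def by (intro sum_mono le)
    define A where "A = (\<Prod>i\<in>?I. \<Prod>j\<in>?I. pochhammer (x i - x j - of_nat (\<gamma> j)) (\<gamma> i))"
    define B where "B = (\<Prod>i\<in>?I. \<Prod>j\<in>?I. pochhammer (1 + x i - x j) (\<gamma> i))"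
    define M where "M = (\<Prod>i\<in>?I. \<Prod>j\<in>?I. pochhammer (x i - x j - of_nat (m j)) (\<gamma> i))"
    define D' where "D' = Delta n (\<lambda>i. x i + of_nat (\<gamma> i))"
    define C where "C = (\<Prod>i\<in>?I. pochhammer (c + x i) (\<gamma> i))"
    define E where "E = (\<Prod>i\<in>?I. pochhammer (d + x i) (\<gamma> i))"
    define E' where "E' = (\<Prod>i\<in>?I. pochhammer (d + x i + of_nat (\<gamma> i)) (m i - \<gamma> i))"
    have B0: "B \<noteq> 0" using ij by (simp add: B_def)
    have E0: "E \<noteq> 0" using dn by (simp add: E_def)
    have AB: "D' * A = (-1) ^ k * Delta n x * B"
      unfolding A_def B_def D'_def k_def by (rule Delta_shift)
    then have A0: "A \<noteq> 0" using B0 \<Delta> by auto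
    have main: "D' / Delta n x * (M / B) = (-1) ^ k * (M / A)"
      using AB A0 B0 \<Delta> by (simp add: field_simps)
    have e1: "pochhammer e1 ?N = pochhammer e1 k * pochhammer (e1 + of_nat k) (?N - k)"
      and e2: "pochhammer e2 ?N = pochhammer e2 k * pochhammer (e2 + of_nat k) (?N - k)"
      by (rule pochhammer_product[OF kN])+
    have dd: "(\<Prod>i\<in>?I. pochhammer (d + x i) (m i)) = E * E'"
      unfolding E_def E'_def prod.distrib[symmetric]
      by (intro prod.cong refl pochhammer_product le)
    have "- of_nat (m j) + x i - x j = x i - x j - of_nat (m j)" for i j by simp
    then have "F_term n m ((a1, a2, c, d, e1, e2), x) \<gamma> = D' / Delta n x * (M / B) * (C / E)
        * ((pochhammer a1 k * pochhammer a2 k) / (pochhammer e1 k * pochhammer e2 k))"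
      unfolding F_term.simps k_def[symmetric] D'_def[symmetric] prod_dividef
        C_def[symmetric] E_def[symmetric] B_def[symmetric] M_def
      by (simp only:)
    then have "pochhammer e1 ?N * pochhammer e2 ?N * (\<Prod>i\<in>?I. pochhammer (d + x i) (m i))
       * F_term n m ((a1, a2, c, d, e1, e2), x) \<gamma>
      = cleared_weight ?N a1 a2 e1 e2 k * (M / A) * C * E'"
      unfolding e1 e2 dd main cleared_weight_def
      using en[folded k_def] E0 by (simp add: field_simps)
    then show "pochhammer e1 ?N * pochhammer e2 ?N * (\<Prod>i\<in>?I. pochhammer (d + x i) (m i))
       * F_term n m ((a1, a2, c, d, e1, e2), x) \<gamma>
      = cleared_weight ?N a1 a2 e1 e2 (\<Sum>i\<in>?I. \<gamma> i)
       * (\<Prod>i\<in>?I. \<Prod>j\<in>?I. pochhammer (x i - x j - of_nat (m j)) (\<gamma> i)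
                        / pochhammer (x i - x j - of_nat (\<gamma> j)) (\<gamma> i))
       * (\<Prod>i\<in>?I. pochhammer (c + x i) (\<gamma> i))
       * (\<Prod>i\<in>?I. pochhammer (d + x i + of_nat (\<gamma> i)) (m i - \<gamma> i))"
      unfolding prod_dividef A_def[symmetric] M_def[symmetric] C_def[symmetric] E'_def[symmetric]
        size_of_def[symmetric] k_def[symmetric] .
  qed
  also have "\<dots> = subset_sum (cleared_weight ?N a1 a2 e1 e2) c d (blocks ?I x m)"
    by (rule subset_sum_blocks[OF sep, symmetric]) simp
  finally show ?thesis .
qed

text \<open>The reflection \<open>u \<mapsto> a - 1 - u\<close> maps the last element of a block to the first of its image.\<close>

lemma blocks_reflect:
  "blocks I (\<lambda>i. - of_nat (m i) + a - x i) m = (\<lambda>u. a - 1 - u) ` blocks I x m"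
proof -
  have flip: "- of_nat (m i) + a - x i + of_nat k = a - 1 - (x i + of_nat (m i - Suc k))"
    if "k < m i" for i k
    using that by (simp add: of_nat_diff algebra_simps)
  show ?thesis
  proof (intro set_eqI iffI)
    fix v assume "v \<in> blocks I (\<lambda>i. - of_nat (m i) + a - x i) m"
    then obtain i k where ik: "i \<in> I" "k < m i" "v = - of_nat (m i) + a - x i + of_nat k"
      by (auto simp: blocks_def)
    then have "x i + of_nat (m i - Suc k) \<in> blocks I x m"
      unfolding blocks_def by (intro image_eqI[of _ _ "(i, m i - Suc k)"]) auto
    then show "v \<in> (\<lambda>u. a - 1 - u) ` blocks I x m"
      unfolding ik(3) flip[OF ik(2)] by (rule imageI)
  next
    fix v assume "v \<in> (\<lambda>u. a - 1 - u) ` blocks I x m"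
    then obtain i k where ik: "i \<in> I" "k < m i" "v = a - 1 - (x i + of_nat k)"
      by (auto simp: blocks_def)
    then have "v = - of_nat (m i) + a - x i + of_nat (m i - Suc k)"
      by (simp add: of_nat_diff algebra_simps)
    then show "v \<in> blocks I (\<lambda>i. - of_nat (m i) + a - x i) m"
      using ik unfolding blocks_def by (intro image_eqI[of _ _ "(i, m i - Suc k)"]) auto
  qed
qed

text \<open>
  The transformation for arbitrary sets. On a chain starting at \<open>z\<close> it is the one-variable transformation
  with \<open>c + z\<close> and \<open>d + z\<close> in place of \<open>c\<close> and \<open>d\<close>, because the reflected chain starts at \<open>- z\<close>.
\<close>

lemma subset_sum_sears:
  fixes a1 a2 c d e1 e2 :: complex
  assumes bal: "a1 + a2 + c + 1 - of_nat N = d + e1 + e2" and S: "finite S" "card S = N"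
  shows "subset_sum (cleared_weight N a1 a2 e1 e2) c d S
    = subset_sum (cleared_weight N a1 (e1 - a2) e1 (e1 + d - a2 - c)) (e1 - c) (e1 + e2 - a2 - c)
        ((\<lambda>u. of_nat N - 1 - u) ` S)"
proof -
  let ?w = "cleared_weight N a1 a2 e1 e2"
  let ?w' = "cleared_weight N a1 (e1 - a2) e1 (e1 + d - a2 - c)"
  let ?r = "\<lambda>u. of_nat N - 1 - u :: complex"
  define f where "f = (\<lambda>S. subset_sum ?w c d S - subset_sum ?w' (e1 - c) (e1 + e2 - a2 - c) (?r ` S))"
  have aff: "affine_in_each f"
    unfolding f_def by (intro affine_in_each_diff affine_in_each_reflect subset_sum_affine)
  have chain: "f ((\<lambda>k. z + of_nat k) ` {..<N}) = 0" for z
  proof -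
    have refl_chain: "?r ` (\<lambda>k. z + of_nat k) ` {..<N} = (\<lambda>k. - z + of_nat k) ` {..<N}"
      using blocks_reflect[where I = "{()}" and m = "\<lambda>_. N" and a = "of_nat N" and x = "\<lambda>_. z"]
      by (simp only: blocks_singleton) simp
    have "a1 + a2 + (c + z) + 1 - of_nat N = (d + z) + e1 + e2"
      using bal by (simp add: algebra_simps)
    from sears[OF this]
    have "subset_sum ?w c d ((\<lambda>k. z + of_nat k) ` {..<N})
        = subset_sum ?w' (e1 - c) (e1 + e2 - a2 - c) ((\<lambda>k. - z + of_nat k) ` {..<N})"
      unfolding subset_sum_chain cleared_weight_def by (simp add: algebra_simps)
    then show ?thesis by (simp add: f_def refl_chain)
  qed
  have "f S = 0"
    by (rule affine_in_each_zero_if_zero_on_chains[OF aff chain S])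
  then show ?thesis by (simp add: f_def)
qed

theorem proposition2p3:
  fixes n :: nat and m :: "nat \<Rightarrow> nat"
    and a1 a2 c d e1 e2 :: complex and x :: "nat \<Rightarrow> complex"
  assumes "n \<ge> 2"
    and "a1 + a2 + c + 1 - of_nat (size_of n m) = d + e1 + e2"
    and "denominators_nonzero n m ((a1, a2, c, d, e1, e2), x)"
    and "denominators_nonzero n m (s1 n m ((a1, a2, c, d, e1, e2), x))"
  shows "F_tilde n m (s0 ((a1, a2, c, d, e1, e2), x)) = F_tilde n m ((a1, a2, c, d, e1, e2), x)
    \<and> F_tilde n m (s1 n m ((a1, a2, c, d, e1, e2), x)) = F_tilde n m ((a1, a2, c, d, e1, e2), x)
    \<and> F_tilde n m (s2 ((a1, a2, c, d, e1, e2), x)) = F_tilde n m ((a1, a2, c, d, e1, e2), x)"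
proof (intro conjI)
  let ?p = "((a1, a2, c, d, e1, e2), x)"
  let ?I = "{1..n}" and ?N = "size_of n m"
  show "F_tilde n m (s0 ?p) = F_tilde n m ?p"
    by (simp add: F_eq_finite_sum mult.commute)
  show "F_tilde n m (s2 ?p) = F_tilde n m ?p"
    by (simp add: F_eq_finite_sum mult.commute)
  have sep: "separated ?I x m"
    using assms(3) by (rule denominators_nonzero_separated)
  have card: "card (blocks ?I x m) = ?N"
    using card_blocks[OF sep, of m] by (simp add: size_of_def)
  have "finite (blocks ?I x m)" by (simp add: blocks_def)
  have "F_tilde n m (s1 n m ?p) = subset_sum (cleared_weight ?N a1 (e1 - a2) e1 (e1 + d - a2 - c))
      (e1 - c) (e1 + e2 - a2 - c) (blocks ?I (\<lambda>i. - of_nat (m i) + of_nat ?N - x i) m)"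
    using assms(4) unfolding s1.simps by (rule F_tilde_eq_subset_sum)
  also have "\<dots> = subset_sum (cleared_weight ?N a1 a2 e1 e2) c d (blocks ?I x m)"
    unfolding blocks_reflect
    by (rule subset_sum_sears[OF assms(2) \<open>finite (blocks ?I x m)\<close> card, symmetric])
  also have "\<dots> = F_tilde n m ?p"
    using assms(3) by (rule F_tilde_eq_subset_sum[symmetric])
  finally show "F_tilde n m (s1 n m ?p) = F_tilde n m ?p" .
qed

end
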